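(* Let $V=V^{no\_DQ}$, let $1\le r\le d$, and let $X^r=\mathrm{span}\{\varphi_1,\dots,\varphi_r\}$ be the corresponding POD space. Let $u$ be the solution of the weak heat equation, $u_r$ the solution of the POD Galerkin reduced order model, $P_r$ the $L^2$ projection onto $X^r$, $\eta^{L^2}:=u-P_r(u)$, $\phi_r:=u_r-P_r(u)$, and $C_{inv}(r):=\sqrt{\|S_r\|_2}$, where $S_r$ is the POD stiffness matrix. Then for all $t\in[0,T]$ $$\frac{d}{dt}\|\nabla\phi_r\|^2\le\nu\,C_{inv}(r)^2\,\|\nabla\eta^{L^2}\|^2 .$$
   Context: Let $\Omega\subset\mathbb{R}^n$ be a bounded domain, $X:=H_0^1(\Omega)$, $T>0$, $\nu>0$; $(\cdot,\cdot)$ and $\|\cdot\|$ are the $L^2(\Omega)$ inner product and norm. A subscript $t$ denotes the time derivative. The function $u(\cdot,t)\in X$, $t\in[0,T]$, is the weak solution of the heat equation: $(u_t,v)+\nu(\nabla u,\nabla v)=(f,v)$ for all $v\in X$. It is assumed that $u\in C^1([0,T];X)$ and $f\in C([0,T];L^2(\Omega))$. Snapshots and POD: given times $t_0,\dots,t_N\in[0,T]$, set $V^{no\_DQ}:=\mathrm{span}\{u(\cdot,t_0),\dots,u(\cdot,t_N)\}$. Write $s_1,\dots,s_M$ ($M=N+1$) for these spanning functions and $d=\dim V^{no\_DQ}$. Let $K\in\mathbb{R}^{M\times M}$, $K_{ij}=\frac1M(s_j,s_i)$, with positive eigenvalues $\lambda_1\ge\dots\ge\lambda_d>0$ and associated orthonormal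 eigenvectors $v_1,\dots,v_d$. The POD basis functions are $\varphi_k=\lambda_k^{-1/2}\sum_{j=1}^M (v_k)_j s_j$, $1\le k\le r$; they are $L^2$-orthonormal and lie in $X$. The POD stiffness matrix is $S_r\in\mathbb{R}^{r\times r}$ with entries $(S_r)_{ij}=(\nabla\varphi_j,\nabla\varphi_i)$, and $\|\cdot\|_2$ is the matrix 2-norm. Reduced order model: $u_r(\cdot,t)\in X^r$ (continuously differentiable in $t$) satisfies $(u_{r,t},v_r)+\nu(\nabla u_r,\nabla v_r)=(f,v_r)$ for all $v_r\in X^r$ and $t\in[0,T]$, with some initial value $u_r(0)\in X^r$. $L^2$ projection: for $w\in X$, $P_r(w)\in X^r$ is defined by $(w-P_r(w),v_r)=0$ for all $v_r\in X^r$; it is applied at each time $t$. *)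

theory Defs
  imports "HOL-Analysis.Analysis" "Jordan_Normal_Form.Char_Poly"
begin

no_notation vec_index (infixl \<open>$\<close> 100)

section \<open>The space of square integrable functions\<close>

text \<open>Elements of Lebesgue and Sobolev spaces are represented by functions on the whole of
  \<open>real ^ 'n\<close>, of which only the restriction to \<open>\<Omega>\<close> matters; equality in the space
  is equality almost everywhere on \<open>\<Omega>\<close>.\<close>

definition L2_space :: "(real ^ 'n) set \<Rightarrow> (real ^ 'n \<Rightarrow> 'b::euclidean_space) set" where
  "L2_space \<Omega> = {w. w \<in> borel_measurable (lebesgue_on \<Omega>) \<and>
                    integrable (lebesgue_on \<Omega>) (\<lambda>x. (norm (w x))\<^sup>2)}"

definition L2_inner ::
  "(real ^ 'n) set \<Rightarrow> (real ^ 'n \<Rightarrow> 'b::euclidean_space) \<Rightarrow> (real ^ 'n \<Rightarrow> 'b) \<Rightarrow> real" where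
  "L2_inner \<Omega> w z = (LINT x|lebesgue_on \<Omega>. inner (w x) (z x))"

definition L2_norm :: "(real ^ 'n) set \<Rightarrow> (real ^ 'n \<Rightarrow> 'b::euclidean_space) \<Rightarrow> real" where
  "L2_norm \<Omega> w = sqrt (L2_inner \<Omega> w w)"

definition L2_span ::
  "(real ^ 'n) set \<Rightarrow> (nat \<Rightarrow> real ^ 'n \<Rightarrow> real) \<Rightarrow> nat set \<Rightarrow> (real ^ 'n \<Rightarrow> real) set" where
  "L2_span \<Omega> b I = {w. \<exists>c. AE x in lebesgue_on \<Omega>. w x = (\<Sum>k\<in>I. c k * b k x)}"

definition L2_independent ::
  "(real ^ 'n) set \<Rightarrow> (nat \<Rightarrow> real ^ 'n \<Rightarrow> real) \<Rightarrow> nat set \<Rightarrow> bool" where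
  "L2_independent \<Omega> b I \<longleftrightarrow>
     (\<forall>c. (AE x in lebesgue_on \<Omega>. (\<Sum>k\<in>I. c k * b k x) = 0) \<longrightarrow> (\<forall>k\<in>I. c k = 0))"

text \<open>\<open>V\<close> has a basis of \<open>d\<close> elements, all linear relations being understood almost
  everywhere.\<close>

definition has_L2_dim :: "(real ^ 'n) set \<Rightarrow> (real ^ 'n \<Rightarrow> real) set \<Rightarrow> nat \<Rightarrow> bool" where
  "has_L2_dim \<Omega> V d \<longleftrightarrow>
     (\<exists>b. (\<forall>k\<in>{1..d}. b k \<in> V) \<and> L2_independent \<Omega> b {1..d} \<and> V \<subseteq> L2_span \<Omega> b {1..d})"

text \<open>The projection is determined up to equality almost everywhere on \<open>\<Omega>\<close>.\<close>

definition L2_proj ::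
  "(real ^ 'n) set \<Rightarrow> (real ^ 'n \<Rightarrow> real) set \<Rightarrow> (real ^ 'n \<Rightarrow> real) \<Rightarrow> real ^ 'n \<Rightarrow> real" where
  "L2_proj \<Omega> Y w = (SOME p. p \<in> Y \<and> (\<forall>z\<in>Y. L2_inner \<Omega> (\<lambda>x. w x - p x) z = 0))"

section \<open>Sobolev spaces\<close>

definition classical_grad :: "(real ^ 'n \<Rightarrow> real) \<Rightarrow> real ^ 'n \<Rightarrow> real ^ 'n" where
  "classical_grad w x = (\<chi> i. frechet_derivative w (at x) (axis i 1))"

fun k_times_cont_diff :: "nat \<Rightarrow> (real ^ 'n \<Rightarrow> real) \<Rightarrow> bool" where
  "k_times_cont_diff 0 w \<longleftrightarrow> continuous_on UNIV w"
| "k_times_cont_diff (Suc k) w \<longleftrightarrow>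
     (\<forall>x. w differentiable (at x)) \<and> (\<forall>i. k_times_cont_diff k (\<lambda>x. classical_grad w x $ i))"

definition test_functions :: "(real ^ 'n) set \<Rightarrow> (real ^ 'n \<Rightarrow> real) set" where
  "test_functions \<Omega> = {\<psi>. (\<forall>k. k_times_cont_diff k \<psi>) \<and>
      compact (closure {x. \<psi> x \<noteq> 0}) \<and> closure {x. \<psi> x \<noteq> 0} \<subseteq> \<Omega>}"

definition is_weak_grad ::
  "(real ^ 'n) set \<Rightarrow> (real ^ 'n \<Rightarrow> real) \<Rightarrow> (real ^ 'n \<Rightarrow> real ^ 'n) \<Rightarrow> bool" where
  "is_weak_grad \<Omega> w g \<longleftrightarrow> w \<in> L2_space \<Omega> \<and> g \<in> L2_space \<Omega> \<and>
     (\<forall>\<psi>\<in>test_functions \<Omega>. \<forall>i.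
        (LINT x|lebesgue_on \<Omega>. w x * classical_grad \<psi> x $ i) =
        - (LINT x|lebesgue_on \<Omega>. g x $ i * \<psi> x))"

text \<open>For open \<open>\<Omega>\<close> the weak gradient is unique up to equality almost everywhere on
  \<open>\<Omega>\<close>.\<close>

definition grad :: "(real ^ 'n) set \<Rightarrow> (real ^ 'n \<Rightarrow> real) \<Rightarrow> real ^ 'n \<Rightarrow> real ^ 'n" where
  "grad \<Omega> w = (SOME g. is_weak_grad \<Omega> w g)"

definition H1_space :: "(real ^ 'n) set \<Rightarrow> (real ^ 'n \<Rightarrow> real) set" where
  "H1_space \<Omega> = {w. \<exists>g. is_weak_grad \<Omega> w g}"

definition H1_norm :: "(real ^ 'n) set \<Rightarrow> (real ^ 'n \<Rightarrow> real) \<Rightarrow> real" where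
  "H1_norm \<Omega> w = sqrt ((L2_norm \<Omega> w)\<^sup>2 + (L2_norm \<Omega> (grad \<Omega> w))\<^sup>2)"

text \<open>The closure of the test functions in \<open>H1_space\<close>.\<close>

definition H10_space :: "(real ^ 'n) set \<Rightarrow> (real ^ 'n \<Rightarrow> real) set" where
  "H10_space \<Omega> = {w \<in> H1_space \<Omega>. \<exists>\<psi>::nat \<Rightarrow> real ^ 'n \<Rightarrow> real.
      (\<forall>m. \<psi> m \<in> test_functions \<Omega>) \<and>
      (\<lambda>m. L2_norm \<Omega> (\<lambda>x. w x - \<psi> m x)) \<longlonglongrightarrow> 0 \<and>
      (\<lambda>m. L2_norm \<Omega> (\<lambda>x. grad \<Omega> w x - classical_grad (\<psi> m) x)) \<longlonglongrightarrow> 0}"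

section \<open>Functions of time\<close>

text \<open>\<open>w \<in> C([0,T]; L\<^sup>2(\<Omega>))\<close>\<close>

definition continuous_into_L2 ::
  "(real ^ 'n) set \<Rightarrow> real \<Rightarrow> (real \<Rightarrow> real ^ 'n \<Rightarrow> real) \<Rightarrow> bool" where
  "continuous_into_L2 \<Omega> T w \<longleftrightarrow> (\<forall>t\<in>{0..T}. w t \<in> L2_space \<Omega> \<and>
     ((\<lambda>s. L2_norm \<Omega> (\<lambda>x. w s x - w t x)) \<longlongrightarrow> 0) (at t within {0..T}))"

text \<open>\<open>w \<in> C\<^sup>1([0,T]; Y)\<close> with time derivative \<open>w'\<close>, where the subspace \<open>Y\<close> of
  \<open>H1_space\<close> carries the norm \<open>H1_norm\<close>.\<close>

definition C1_into ::
  "(real ^ 'n) set \<Rightarrow> (real ^ 'n \<Rightarrow> real) set \<Rightarrow> real \<Rightarrow>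
   (real \<Rightarrow> real ^ 'n \<Rightarrow> real) \<Rightarrow> (real \<Rightarrow> real ^ 'n \<Rightarrow> real) \<Rightarrow> bool" where
  "C1_into \<Omega> Y T w w' \<longleftrightarrow> (\<forall>t\<in>{0..T}. w t \<in> Y \<and> w' t \<in> Y \<and>
     ((\<lambda>s. H1_norm \<Omega> (\<lambda>x. (w s x - w t x) / (s - t) - w' t x)) \<longlongrightarrow> 0) (at t within {0..T}) \<and>
     ((\<lambda>s. H1_norm \<Omega> (\<lambda>x. w' s x - w' t x)) \<longlongrightarrow> 0) (at t within {0..T}))"

section \<open>Matrices\<close>

definition vec_norm2 :: "real Matrix.vec \<Rightarrow> real" where
  "vec_norm2 x = L2_set (vec_index x) {..<dim_vec x}"

definition mat_norm2 :: "real mat \<Rightarrow> real" where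
  "mat_norm2 A = (SUP x\<in>carrier_vec (dim_col A). vec_norm2 (A *\<^sub>v x) / vec_norm2 x)"

section \<open>Proper orthogonal decomposition\<close>

text \<open>The snapshots are \<open>s 0, \<dots>, s (M - 1)\<close>; matrix and vector indices start at 0.
  Eigenpairs and modes are numbered from 1.\<close>

definition snapshot_matrix ::
  "(real ^ 'n) set \<Rightarrow> nat \<Rightarrow> (nat \<Rightarrow> real ^ 'n \<Rightarrow> real) \<Rightarrow> real mat" where
  "snapshot_matrix \<Omega> M s = mat M M (\<lambda>(i, j). 1 / real M * L2_inner \<Omega> (s j) (s i))"

definition ordered_eigenpairs ::
  "real mat \<Rightarrow> nat \<Rightarrow> (nat \<Rightarrow> real) \<Rightarrow> (nat \<Rightarrow> real Matrix.vec) \<Rightarrow> bool" where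
  "ordered_eigenpairs K d lam v \<longleftrightarrow>
     (\<forall>k\<in>{1..d}. lam k > 0 \<and> eigenvector K (v k) (lam k)) \<and>
     (\<forall>k\<in>{1..d}. \<forall>l\<in>{1..d}. k \<le> l \<longrightarrow> lam l \<le> lam k) \<and>
     (\<forall>k\<in>{1..d}. \<forall>l\<in>{1..d}. scalar_prod (v k) (v l) = (if k = l then 1 else 0))"

definition pod_mode ::
  "nat \<Rightarrow> (nat \<Rightarrow> real ^ 'n \<Rightarrow> real) \<Rightarrow> (nat \<Rightarrow> real) \<Rightarrow> (nat \<Rightarrow> real Matrix.vec) \<Rightarrow>
   nat \<Rightarrow> real ^ 'n \<Rightarrow> real" where
  "pod_mode M s lam v k = (\<lambda>x. lam k powr (- 1 / 2) * (\<Sum>j<M. vec_index (v k) j * s j x))"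

definition stiffness_matrix ::
  "(real ^ 'n) set \<Rightarrow> nat \<Rightarrow> (nat \<Rightarrow> real ^ 'n \<Rightarrow> real) \<Rightarrow> real mat" where
  "stiffness_matrix \<Omega> r \<phi> = mat r r (\<lambda>(i, j).
     L2_inner \<Omega> (grad \<Omega> (\<phi> (Suc j))) (grad \<Omega> (\<phi> (Suc i))))"

definition C_inv :: "real mat \<Rightarrow> real" where
  "C_inv S = sqrt (mat_norm2 S)"

section \<open>Galerkin formulation of the heat equation\<close>

text \<open>With \<open>Y = H10_space \<Omega>\<close> this is the weak heat equation, with \<open>Y\<close> the POD space it is
  the reduced order model; \<open>w'\<close> is the time derivative of \<open>w\<close>.\<close>

definition solves_heat ::
  "(real ^ 'n) set \<Rightarrow> (real ^ 'n \<Rightarrow> real) set \<Rightarrow> real \<Rightarrow> real \<Rightarrow> (real \<Rightarrow> real ^ 'n \<Rightarrow> real) \<Rightarrow>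
   (real \<Rightarrow> real ^ 'n \<Rightarrow> real) \<Rightarrow> (real \<Rightarrow> real ^ 'n \<Rightarrow> real) \<Rightarrow> bool" where
  "solves_heat \<Omega> Y T \<nu> f w w' \<longleftrightarrow> C1_into \<Omega> Y T w w' \<and>
     (\<forall>t\<in>{0..T}. \<forall>z\<in>Y.
        L2_inner \<Omega> (w' t) z + \<nu> * L2_inner \<Omega> (grad \<Omega> (w t)) (grad \<Omega> z) = L2_inner \<Omega> (f t) z)"

end

(*
  Write phi_r = sum_k a_k phi_k with a_k = (u_r - u, phi_k) / M. Subtracting the two Galerkin
  equations tested with phi_k, and using u_r - u = phi_r - eta, gives
    M a_k' = nu ((grad eta, grad phi_k) - (grad phi_r, grad phi_k)).
  Multiplying by a_k' and summing turns the derivative D = 2 sum_k a_k' (grad phi_r, grad phi_k)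
  of |grad phi_r|^2 into
    nu D = 2 nu (grad eta, grad psi) - 2 M |a'|^2,   psi = sum_k a_k' phi_k,
  and |grad psi| <= C_inv |a'| together with Young's inequality absorbs the last term.
  All manipulations of gradients rest on the almost everywhere uniqueness of weak gradients.
*)

theory Submission
  imports Defs
begin

text \<open>The function psi in the estimate is the time derivative of
  \<open>\<phi>\<^sub>r\<close>, so the argument amounts to testing the error equation with that
  derivative. The modes have squared norm M, so 2 M |a'|^2 is twice the squared L2 norm of psi; this
  dissipative term pays for the factor |a'| that the inverse inequality brings in.

  Coefficients are used because of representation: projections and gradients are arbitrary choices
  among functions equal almost everywhere, made separately at each time, so nothing can be
  differentiated in time pointwise. The numbers a_k are free of these choices. As \<eta> is
  orthogonal to every mode, the projection drops out of them, and their derivatives need only the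
  time derivatives of u and u_r.

  Almost everywhere uniqueness of weak gradients is the fundamental lemma of the calculus of
  variations, which requires a supply of genuinely smooth test functions with compact support. They
  are built from exp(-1/y), and they approximate indicators of boxes, which is all that Lebesgue
  differentiation asks for.\<close>

section \<open>Square integrable functions\<close>

text \<open>Lebesgue measure is complete, so measurability survives a change on a null set.
  Extension by zero brings the question from \<open>\<Omega>\<close> to the whole space, where
  completeness applies.\<close>

lemma L2_space_cong_AE:
  assumes "\<Omega> \<in> sets lebesgue" "w \<in> L2_space \<Omega>" "AE x in lebesgue_on \<Omega>. w x = z x"
  shows "z \<in> L2_space \<Omega>"
proof -
  have meas: "z \<in> borel_measurable (lebesgue_on \<Omega>)"
  proof -
    have "(\<lambda>x. indicator \<Omega> x *\<^sub>R w x) \<in> borel_measurable lebesgue"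
      using assms by (simp add: L2_space_def borel_measurable_restrict_space_iff)
    moreover have "AE x in lebesgue. indicator \<Omega> x *\<^sub>R w x = indicator \<Omega> x *\<^sub>R z x"
      using assms by (simp add: AE_restrict_space_iff indicator_def) (auto elim: eventually_mono)
    ultimately have "(\<lambda>x. indicator \<Omega> x *\<^sub>R z x) \<in> borel_measurable lebesgue"
      by (rule borel_measurable_AE)
    then show ?thesis
      using assms by (simp add: borel_measurable_restrict_space_iff)
  qed
  have "integrable (lebesgue_on \<Omega>) (\<lambda>x. (norm (z x))\<^sup>2)"
    by (rule integrable_cong_AE_imp [where g = "\<lambda>x. (norm (w x))\<^sup>2"])
       (use assms meas in \<open>auto simp: L2_space_def elim: eventually_mono\<close>)
  with meas show ?thesis by (simp add: L2_space_def)
qed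

lemma L2_space_integrable_inner:
  assumes "w \<in> L2_space \<Omega>" "z \<in> L2_space \<Omega>"
  shows "integrable (lebesgue_on \<Omega>) (\<lambda>x. inner (w x) (z x))"
proof (rule Bochner_Integration.integrable_bound)
  show "integrable (lebesgue_on \<Omega>) (\<lambda>x. (norm (w x))\<^sup>2 + (norm (z x))\<^sup>2)"
    using assms by (auto simp: L2_space_def)
  show "(\<lambda>x. inner (w x) (z x)) \<in> borel_measurable (lebesgue_on \<Omega>)"
    using assms by (auto simp: L2_space_def)
  show "AE x in lebesgue_on \<Omega>. norm (inner (w x) (z x)) \<le> norm ((norm (w x))\<^sup>2 + (norm (z x))\<^sup>2)"
  proof (rule always_eventually, rule allI)
    fix x
    have "\<bar>inner (w x) (z x)\<bar> \<le> norm (w x) * norm (z x)" by (rule Cauchy_Schwarz_ineq2)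
    also have "\<dots> \<le> (norm (w x))\<^sup>2 + (norm (z x))\<^sup>2"
      using sum_squares_bound [of "norm (w x)" "norm (z x)"]
        mult_nonneg_nonneg [OF norm_ge_zero [of "w x"] norm_ge_zero [of "z x"]]
      by linarith
    finally show "norm (inner (w x) (z x)) \<le> norm ((norm (w x))\<^sup>2 + (norm (z x))\<^sup>2)" by simp
  qed
qed

lemma L2_space_add:
  assumes "w \<in> L2_space \<Omega>" "z \<in> L2_space \<Omega>"
  shows "(\<lambda>x. w x + z x) \<in> L2_space \<Omega>"
proof -
  have "(\<lambda>x. (norm (w x + z x))\<^sup>2) =
        (\<lambda>x. (norm (w x))\<^sup>2 + 2 * inner (w x) (z x) + (norm (z x))\<^sup>2)"
    by (simp add: power2_norm_eq_inner inner_add_left inner_add_right inner_commute algebra_simps)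
  then show ?thesis
    using assms L2_space_integrable_inner [OF assms] by (auto simp: L2_space_def)
qed

lemma L2_space_scaleR:
  assumes "w \<in> L2_space \<Omega>"
  shows "(\<lambda>x. c *\<^sub>R w x) \<in> L2_space \<Omega>"
  using assms by (auto simp: L2_space_def power_mult_distrib)

lemma L2_space_zero: "(\<lambda>x. 0) \<in> L2_space \<Omega>"
  by (simp add: L2_space_def)

lemma L2_space_diff:
  assumes "w \<in> L2_space \<Omega>" "z \<in> L2_space \<Omega>"
  shows "(\<lambda>x. w x - z x) \<in> L2_space \<Omega>"
  using L2_space_add [OF assms(1) L2_space_scaleR [OF assms(2), of "-1"]] by simp

lemma L2_space_sum:
  assumes "\<And>k. k \<in> I \<Longrightarrow> z k \<in> L2_space \<Omega>"
  shows "(\<lambda>x. \<Sum>k\<in>I. c k *\<^sub>R z k x) \<in> L2_space \<Omega>"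
  using assms
  by (induction I rule: infinite_finite_induct)
     (simp_all add: L2_space_zero L2_space_add L2_space_scaleR)

section \<open>Bilinearity of the L2 inner product and the Cauchy-Schwarz inequality\<close>

lemma L2_inner_commute: "L2_inner \<Omega> w z = L2_inner \<Omega> z w"
  by (simp add: L2_inner_def inner_commute)

lemma L2_inner_cong_AE:
  assumes "\<Omega> \<in> sets lebesgue" "w \<in> L2_space \<Omega>" "z \<in> L2_space \<Omega>"
    and "AE x in lebesgue_on \<Omega>. w x = w' x" "AE x in lebesgue_on \<Omega>. z x = z' x"
  shows "L2_inner \<Omega> w z = L2_inner \<Omega> w' z'"
proof -
  have "w' \<in> L2_space \<Omega>" "z' \<in> L2_space \<Omega>"
    using L2_space_cong_AE [OF assms(1,2,4)] L2_space_cong_AE [OF assms(1,3,5)] .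
  with assms show ?thesis
    unfolding L2_inner_def
    by (intro integral_cong_AE) (auto simp: L2_space_def)
qed

lemma L2_inner_add_right:
  assumes "w \<in> L2_space \<Omega>" "z \<in> L2_space \<Omega>" "z' \<in> L2_space \<Omega>"
  shows "L2_inner \<Omega> w (\<lambda>x. z x + z' x) = L2_inner \<Omega> w z + L2_inner \<Omega> w z'"
  using assms by (simp add: L2_inner_def inner_add_right L2_space_integrable_inner)

lemma L2_inner_diff_left:
  assumes "w \<in> L2_space \<Omega>" "z \<in> L2_space \<Omega>" "z' \<in> L2_space \<Omega>"
  shows "L2_inner \<Omega> (\<lambda>x. z x - z' x) w = L2_inner \<Omega> z w - L2_inner \<Omega> z' w"
  using assms by (simp add: L2_inner_def inner_diff_left L2_space_integrable_inner)

lemma L2_inner_scaleR_right: "L2_inner \<Omega> w (\<lambda>x. c *\<^sub>R z x) = c * L2_inner \<Omega> w z"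
  by (simp add: L2_inner_def)

lemma L2_inner_sum_right:
  assumes "w \<in> L2_space \<Omega>" "\<And>k. k \<in> I \<Longrightarrow> z k \<in> L2_space \<Omega>"
  shows "L2_inner \<Omega> w (\<lambda>x. \<Sum>k\<in>I. c k *\<^sub>R z k x) = (\<Sum>k\<in>I. c k * L2_inner \<Omega> w (z k))"
  using assms
proof (induction I rule: infinite_finite_induct)
  case (insert k I)
  then have "L2_inner \<Omega> w (\<lambda>x. c k *\<^sub>R z k x + (\<Sum>k\<in>I. c k *\<^sub>R z k x)) =
      L2_inner \<Omega> w (\<lambda>x. c k *\<^sub>R z k x) + L2_inner \<Omega> w (\<lambda>x. \<Sum>k\<in>I. c k *\<^sub>R z k x)"
    by (intro L2_inner_add_right L2_space_sum L2_space_scaleR) auto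
  with insert show ?case by (simp add: L2_inner_scaleR_right)
qed (simp_all add: L2_inner_def)

lemma L2_inner_sum_left:
  assumes "w \<in> L2_space \<Omega>" "\<And>k. k \<in> I \<Longrightarrow> z k \<in> L2_space \<Omega>"
  shows "L2_inner \<Omega> (\<lambda>x. \<Sum>k\<in>I. c k *\<^sub>R z k x) w = (\<Sum>k\<in>I. c k * L2_inner \<Omega> (z k) w)"
  using L2_inner_sum_right [where c = c, OF assms]
  by (subst L2_inner_commute) (simp add: L2_inner_commute [of _ _ w])

lemma L2_inner_nonneg: "0 \<le> L2_inner \<Omega> w w"
  by (simp add: L2_inner_def)

lemma L2_norm_nonneg: "0 \<le> L2_norm \<Omega> w"
  by (simp add: L2_norm_def L2_inner_nonneg)

lemma L2_norm_squared: "(L2_norm \<Omega> w)\<^sup>2 = L2_inner \<Omega> w w"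
  by (simp add: L2_norm_def L2_inner_nonneg)

text \<open>The square of \<open>w + c z\<close> integrates to a quadratic polynomial in
  \<open>c\<close> that is nowhere negative. \<open>L2_inner\<close> is only semidefinite on
  functions, so a vanishing leading coefficient does not mean \<open>z = 0\<close>; that case is
  settled by the affine function that remains.\<close>

lemma L2_Cauchy_Schwarz:
  assumes "w \<in> L2_space \<Omega>" "z \<in> L2_space \<Omega>"
  shows "\<bar>L2_inner \<Omega> w z\<bar> \<le> L2_norm \<Omega> w * L2_norm \<Omega> z"
proof -
  have quad: "0 \<le> L2_inner \<Omega> w w + 2 * c * L2_inner \<Omega> w z + c\<^sup>2 * L2_inner \<Omega> z z" for c
  proof -
    have "(\<lambda>x. inner (w x + c *\<^sub>R z x) (w x + c *\<^sub>R z x)) =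
        (\<lambda>x. inner (w x) (w x) + 2 * c * inner (w x) (z x) + c\<^sup>2 * inner (z x) (z x))"
      by (simp add: inner_add_left inner_add_right inner_commute algebra_simps power2_eq_square)
    then have "L2_inner \<Omega> (\<lambda>x. w x + c *\<^sub>R z x) (\<lambda>x. w x + c *\<^sub>R z x) =
        L2_inner \<Omega> w w + 2 * c * L2_inner \<Omega> w z + c\<^sup>2 * L2_inner \<Omega> z z"
      using assms by (simp add: L2_inner_def L2_space_integrable_inner)
    then show ?thesis using L2_inner_nonneg by metis
  qed
  let ?a = "L2_inner \<Omega> z z" and ?b = "L2_inner \<Omega> w z" and ?c = "L2_inner \<Omega> w w"
  have "?b\<^sup>2 \<le> ?c * ?a"
  proof (cases "?a = 0")
    case True
    have "?b = 0"
    proof (rule ccontr)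
      assume b: "?b \<noteq> 0"
      \<comment> \<open>At this value of \<open>c\<close> the affine function equals -1.\<close>
      have "2 * (- (?c + 1) / (2 * ?b)) * ?b = - (?c + 1)" using b by simp
      with quad [of "- (?c + 1) / (2 * ?b)"] True show False by simp
    qed
    with True show ?thesis by simp
  next
    case False
    then have pos: "0 < ?a" using L2_inner_nonneg [of \<Omega> z] by simp
    \<comment> \<open>The quadratic polynomial is evaluated at its minimiser
      \<open>- ?b / ?a\<close>.\<close>
    have "?c + 2 * (- ?b / ?a) * ?b + (- ?b / ?a)\<^sup>2 * ?a = ?c - ?b\<^sup>2 / ?a"
      using pos by (simp add: power2_eq_square field_simps)
    with quad [of "- ?b / ?a"] have "?b\<^sup>2 / ?a \<le> ?c" by simp
    with pos show ?thesis by (simp add: field_simps)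
  qed
  then have "sqrt (?b\<^sup>2) \<le> sqrt (?c * ?a)" by (rule real_sqrt_le_mono)
  then show ?thesis by (simp add: L2_norm_def real_sqrt_mult)
qed

section \<open>Smooth bump functions, and functions orthogonal to all of them\<close>

section \<open>The fundamental lemma of the calculus of variations\<close>

text \<open>For \<open>p = 1\<close> this is the classical function exp(-1/y), all of whose
  derivatives vanish at 0. The polynomial in 1/y makes the family closed under
  differentiation.\<close>

definition flat :: "real poly \<Rightarrow> real \<Rightarrow> real" where
  "flat p y = (if 0 < y then poly p (inverse y) * exp (- inverse y) else 0)"

lemma poly_times_exp_tendsto_0:
  "((\<lambda>x::real. poly p x * exp (- x)) \<longlongrightarrow> 0) at_top"
proof -
  have "((\<lambda>x::real. \<Sum>i\<le>degree p. coeff p i * (x ^ i / exp x)) \<longlongrightarrow> (\<Sum>i\<le>degree p. coeff p i * 0)) at_top"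
    by (intro tendsto_intros tendsto_power_div_exp_0)
  then show ?thesis
    by (simp add: poly_altdef sum_distrib_right exp_minus divide_inverse mult.assoc)
qed

lemma flat_tendsto_0: "(flat p \<longlongrightarrow> 0) (at 0)"
proof -
  have "((\<lambda>y. poly p (inverse y) * exp (- inverse y)) \<longlongrightarrow> 0) (at_right 0)"
    by (rule filterlim_compose [OF poly_times_exp_tendsto_0 filterlim_inverse_at_top_right])
  then have "(flat p \<longlongrightarrow> 0) (at_right 0)"
    by (rule Lim_transform_eventually)
       (auto simp: flat_def eventually_at_right_field intro!: exI [of _ 1])
  moreover have "(flat p \<longlongrightarrow> 0) (at_left 0)"
    by (rule Lim_transform_eventually [where f = "\<lambda>_. 0", OF tendsto_const])
       (auto simp: flat_def eventually_at_left_field intro!: exI [of _ "-1"])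
  ultimately show ?thesis
    by (simp add: filterlim_split_at)
qed

text \<open>With x = 1/y, the chain rule gives x^2 (p(x) - p'(x)) exp(-x); the coefficient list
  \<open>[:0, 0, 1:]\<close> is the polynomial x^2.\<close>

lemma flat_has_derivative:
  "(flat p has_real_derivative flat ([:0, 0, 1:] * (p - pderiv p)) y) (at y)"
proof -
  consider "y > 0" | "y < 0" | "y = 0" by linarith
  then show ?thesis
  proof cases
    case 1
    have i: "(inverse has_real_derivative - (inverse y ^ Suc (Suc 0))) (at y)"
      using 1 by (intro DERIV_inverse) simp
    have "((\<lambda>y. exp (- inverse y)) has_real_derivative
        exp (- inverse y) * - (- (inverse y ^ Suc (Suc 0)))) (at y)"
      by (intro DERIV_chain2 [OF DERIV_exp] DERIV_minus i)
    from DERIV_mult [OF DERIV_chain2 [OF poly_DERIV i] this]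
    have "((\<lambda>y. poly p (inverse y) * exp (- inverse y)) has_real_derivative
        flat ([:0, 0, 1:] * (p - pderiv p)) y) (at y)"
      using 1 by (simp add: flat_def algebra_simps)
    moreover have "\<forall>\<^sub>F z in nhds y. poly p (inverse z) * exp (- inverse z) = flat p z"
      by (rule eventually_mono [OF eventually_nhds_in_open [of "{0<..}" y]])
         (use 1 in \<open>auto simp: flat_def\<close>)
    ultimately show ?thesis
      by (rule DERIV_cong_ev [THEN iffD1, OF refl _ refl, rotated])
  next
    case 2
    have "((\<lambda>y. 0) has_real_derivative flat ([:0, 0, 1:] * (p - pderiv p)) y) (at y)"
      using 2 by (auto simp: flat_def)
    moreover have "\<forall>\<^sub>F z in nhds y. 0 = flat p z"
      by (rule eventually_mono [OF eventually_nhds_in_open [of "{..<0}" y]])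
         (use 2 in \<open>auto simp: flat_def\<close>)
    ultimately show ?thesis
      by (rule DERIV_cong_ev [THEN iffD1, OF refl _ refl, rotated])
  next
    case 3
    \<comment> \<open>Dividing by h multiplies the polynomial by its variable, so the difference
      quotient at 0 belongs to the family again and its limit is already known.\<close>
    have "(\<lambda>h. (flat p (0 + h) - flat p 0) / h) = flat ([:0, 1:] * p)"
      by (auto simp: flat_def fun_eq_iff divide_inverse)
    then show ?thesis
      using 3 flat_tendsto_0 [of "[:0, 1:] * p"] by (simp add: DERIV_def flat_def)
  qed
qed

text \<open>An algebra of functions closed under partial derivatives, so that all its members are
  smooth.\<close>

inductive_set flat_algebra :: "(real ^ 'n \<Rightarrow> real) set" where
  const: "(\<lambda>x. c) \<in> flat_algebra"
| flat: "(\<lambda>x. flat p (a * (x $ i) + b)) \<in> flat_algebra"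
| add: "w \<in> flat_algebra \<Longrightarrow> z \<in> flat_algebra \<Longrightarrow> (\<lambda>x. w x + z x) \<in> flat_algebra"
| mult: "w \<in> flat_algebra \<Longrightarrow> z \<in> flat_algebra \<Longrightarrow> (\<lambda>x. w x * z x) \<in> flat_algebra"

lemma flat_algebra_prod:
  "(\<And>i. i \<in> I \<Longrightarrow> w i \<in> flat_algebra) \<Longrightarrow> (\<lambda>x. \<Prod>i\<in>I. w i x) \<in> flat_algebra"
  by (induction I rule: infinite_finite_induct) (auto intro: flat_algebra.intros)

lemma flat_algebra_has_derivative:
  fixes w :: "real ^ 'n \<Rightarrow> real"
  assumes "w \<in> flat_algebra"
  shows "\<exists>w'. (\<forall>x. (w has_derivative w' x) (at x)) \<and> (\<forall>h. (\<lambda>x. w' x h) \<in> flat_algebra)"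
  using assms
proof induction
  case (const c)
  show ?case
    by (rule exI [of _ "\<lambda>x h. 0"]) (auto intro: flat_algebra.const)
next
  case (flat p a i b)
  let ?q = "[:0, 0, 1:] * (p - pderiv p)"
  have "((\<lambda>x::real ^ 'n. flat p (a * (x $ i) + b)) has_derivative
      (\<lambda>h. flat ?q (a * (x $ i) + b) * (a * h $ i))) (at x)" for x
  proof -
    have "((\<lambda>x::real ^ 'n. a * (x $ i) + b) has_derivative (\<lambda>h. a * h $ i)) (at x)"
      by (auto intro!: derivative_eq_intros bounded_linear_imp_has_derivative bounded_linear_vec_nth)
    from has_derivative_compose [OF this flat_has_derivative [of p, unfolded has_field_derivative_def]]
    show ?thesis .
  qed
  moreover have "(\<lambda>x::real ^ 'n. flat ?q (a * (x $ i) + b) * (a * h $ i)) \<in> flat_algebra" for h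
    by (intro flat_algebra.intros)
  ultimately show ?case
    by (intro exI [of _ "\<lambda>x h. flat ?q (a * (x $ i) + b) * (a * h $ i)"]) auto
next
  case (add w z)
  then obtain w' z' where
    w: "\<And>x. (w has_derivative w' x) (at x)" "\<And>h. (\<lambda>x. w' x h) \<in> flat_algebra" and
    z: "\<And>x. (z has_derivative z' x) (at x)" "\<And>h. (\<lambda>x. z' x h) \<in> flat_algebra"
    by metis
  show ?case
    by (rule exI [of _ "\<lambda>x h. w' x h + z' x h"])
       (auto intro!: has_derivative_add w z flat_algebra.intros)
next
  case (mult w z)
  then obtain w' z' where
    w: "\<And>x. (w has_derivative w' x) (at x)" "\<And>h. (\<lambda>x. w' x h) \<in> flat_algebra" and
    z: "\<And>x. (z has_derivative z' x) (at x)" "\<And>h. (\<lambda>x. z' x h) \<in> flat_algebra"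
    by metis
  show ?case
    by (rule exI [of _ "\<lambda>x h. w x * z' x h + w' x h * z x"])
       (auto intro!: has_derivative_mult w z flat_algebra.intros mult.hyps)
qed

lemma flat_algebra_smooth:
  fixes w :: "real ^ 'n \<Rightarrow> real"
  assumes "w \<in> flat_algebra"
  shows "k_times_cont_diff k w"
  using assms
proof (induction k arbitrary: w)
  case (0 w)
  then have "continuous (at x) w" for x
    using flat_algebra_has_derivative has_derivative_continuous by blast
  then show ?case by (simp add: continuous_at_imp_continuous_on)
next
  case (Suc k w)
  obtain w' where w': "\<And>x. (w has_derivative w' x) (at x)"
      "\<And>h. (\<lambda>x. w' x h) \<in> flat_algebra"
    using flat_algebra_has_derivative [OF Suc.prems] by blast
  have "(\<lambda>x. classical_grad w x $ i) = (\<lambda>x. w' x (axis i 1))" for i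
    using frechet_derivative_at [OF w'(1)] by (simp add: classical_grad_def)
  with w' Suc.IH show ?case by (auto simp: differentiable_def)
qed

text \<open>An approximation of the indicator of \<open>box a b\<close> by smooth functions:
  \<open>flat 1 (m y)\<close> is exp(-1/(m y)) for y > 0, which tends to 1 with growing m, and it is
  0 for y \<le> 0. All values stay in [0, 1], as dominated convergence will require.\<close>

definition bump :: "real ^ 'n \<Rightarrow> real ^ 'n \<Rightarrow> nat \<Rightarrow> real ^ 'n \<Rightarrow> real" where
  "bump a b m x = (\<Prod>i\<in>UNIV. flat 1 (real m * (x $ i - a $ i)) * flat 1 (real m * (b $ i - x $ i)))"

lemma flat_1_bounds: "0 \<le> flat 1 y" "flat 1 y \<le> 1"
  by (auto simp: flat_def)

lemma bump_bounds: "0 \<le> bump a b m x" "bump a b m x \<le> 1"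
  by (auto simp: bump_def intro!: prod_nonneg prod_le_1 mult_le_one mult_nonneg_nonneg flat_1_bounds)

lemma bump_eq_0:
  assumes "x \<notin> box a b"
  shows "bump a b m x = 0"
proof -
  obtain i where "x $ i - a $ i \<le> 0 \<or> b $ i - x $ i \<le> 0"
    using assms by (force simp: mem_box_cart not_less)
  then have "flat 1 (real m * (x $ i - a $ i)) * flat 1 (real m * (b $ i - x $ i)) = 0"
    by (auto simp: flat_def zero_less_mult_iff)
  then show ?thesis unfolding bump_def by (meson UNIV_I finite prod_zero)
qed

lemma bump_tendsto_1:
  assumes "x \<in> box a b"
  shows "(\<lambda>m. bump a b m x) \<longlonglongrightarrow> 1"
proof -
  have "(\<lambda>m. flat 1 (real m * c)) \<longlonglongrightarrow> 1" if "c > 0" for c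
  proof -
    have "(\<lambda>m. exp (- (inverse (real m) * inverse c))) \<longlonglongrightarrow> exp (- (0 * inverse c))"
      by (intro tendsto_intros lim_inverse_n)
    \<comment> \<open>At m = 0 the two sides differ: the left one is 1 because
      \<open>inverse 0 = 0\<close>, the right one is 0.\<close>
    moreover have "\<forall>\<^sub>F m in sequentially. exp (- (inverse (real m) * inverse c)) = flat 1 (real m * c)"
      using eventually_gt_at_top [of 0]
      by eventually_elim (use that in \<open>auto simp: flat_def\<close>)
    ultimately show ?thesis
      by (simp add: Lim_transform_eventually)
  qed
  then have "(\<lambda>m. bump a b m x) \<longlonglongrightarrow> (\<Prod>i\<in>(UNIV::'a set). 1 * 1)"
    using assms unfolding bump_def
    by (intro tendsto_intros) (auto simp: mem_box_cart)
  then show ?thesis by simp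
qed

text \<open>The function vanishes outside the open box, so its support is contained in the closed
  one; hence the hypothesis on \<open>cbox\<close>.\<close>

lemma bump_test_function:
  assumes "cbox a b \<subseteq> \<Omega>"
  shows "bump a b m \<in> test_functions \<Omega>"
proof -
  \<comment> \<open>Each factor is brought into the affine form in one coordinate that the
    generators of \<open>flat_algebra\<close> have.\<close>
  have "bump a b m = (\<lambda>x. \<Prod>i\<in>UNIV. flat 1 (real m * (x $ i) + - (real m * (a $ i))) *
      flat 1 (- real m * (x $ i) + real m * (b $ i)))"
    by (simp add: bump_def fun_eq_iff algebra_simps)
  then have "bump a b m \<in> flat_algebra"
    by (simp only:) (intro flat_algebra_prod flat_algebra.intros)
  moreover have supp: "closure {x. bump a b m x \<noteq> 0} \<subseteq> cbox a b"
    using bump_eq_0 box_subset_cbox by (intro closure_minimal) blast+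
  moreover have "compact (closure {x. bump a b m x \<noteq> 0})"
    using supp bounded_subset [OF bounded_cbox] by (auto simp: compact_eq_bounded_closed)
  ultimately show ?thesis
    using assms flat_algebra_smooth by (auto simp: test_functions_def)
qed

text \<open>The indicator of the open box is a pointwise limit of test functions bounded by 1, so
  dominated convergence with majorant |g| extends the orthogonality to it. The faces of the box do
  not change the integral.\<close>

lemma integral_box_eq_0_if_orthogonal_to_test_functions:
  fixes g :: "real ^ 'n \<Rightarrow> real"
  assumes "\<Omega> \<in> sets lebesgue" "integrable (lebesgue_on \<Omega>) g" "cbox a b \<subseteq> \<Omega>"
    and orth: "\<And>\<psi>. \<psi> \<in> test_functions \<Omega> \<Longrightarrow> (LINT x|lebesgue_on \<Omega>. g x * \<psi> x) = 0"
  shows "integral (cbox a b) g = 0"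
proof -
  have test: "bump a b m \<in> test_functions \<Omega>" for m
    using assms by (intro bump_test_function)
  have "k_times_cont_diff 0 (bump a b m)" for m
    using test unfolding test_functions_def by blast
  then have "continuous_on UNIV (bump a b m)" for m by simp
  then have meas: "bump a b m \<in> borel_measurable (lebesgue_on \<Omega>)" for m
    by (intro measurable_restrict_space1 measurable_completion)
       (simp add: borel_measurable_continuous_onI)
  have ind: "(\<lambda>m. bump a b m x) \<longlonglongrightarrow> indicator (box a b) x" for x
    using bump_tendsto_1 [of x a b] bump_eq_0 [of x a b] by (cases "x \<in> box a b") simp_all
  have "(\<lambda>m. LINT x|lebesgue_on \<Omega>. g x * bump a b m x) \<longlonglongrightarrow>
      (LINT x|lebesgue_on \<Omega>. g x * indicator (box a b) x)"
  proof (rule integral_dominated_convergence [where w = "\<lambda>x. norm (g x)"])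
    show "(\<lambda>x. g x * indicator (box a b) x) \<in> borel_measurable (lebesgue_on \<Omega>)"
      by (rule borel_measurable_LIMSEQ_real [where u = "\<lambda>m x. g x * bump a b m x"])
         (use assms meas ind in \<open>auto intro!: tendsto_intros borel_measurable_integrable\<close>)
    show "AE x in lebesgue_on \<Omega>. (\<lambda>m. g x * bump a b m x) \<longlonglongrightarrow> g x * indicator (box a b) x"
      by (auto intro!: tendsto_intros ind)
    show "AE x in lebesgue_on \<Omega>. norm (g x * bump a b m x) \<le> norm (g x)" for m
      using bump_bounds [of a b m] by (auto simp: abs_mult intro!: mult_left_le)
    show "(\<lambda>x. g x * bump a b m x) \<in> borel_measurable (lebesgue_on \<Omega>)" for m
      using assms meas by (auto intro!: borel_measurable_integrable)
  qed (use assms in auto)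
  moreover have "(LINT x|lebesgue_on \<Omega>. g x * bump a b m x) = 0" for m
    using orth [OF test] .
  ultimately have zero: "(LINT x|lebesgue_on \<Omega>. g x * indicator (box a b) x) = 0"
    by (simp add: LIMSEQ_const_iff)
  have box: "box a b \<subseteq> \<Omega>" using assms(3) box_subset_cbox [of a b] by blast
  have "(LINT x|lebesgue_on \<Omega>. g x * indicator (box a b) x) = (LINT x|lebesgue_on (box a b). g x)"
  proof -
    have "(LINT x|lebesgue_on \<Omega>. g x * indicator (box a b) x) =
        (LINT x|lebesgue. indicator \<Omega> x *\<^sub>R (g x * indicator (box a b) x))"
      using assms by (simp add: integral_restrict_space)
    also have "\<dots> = (LINT x|lebesgue. indicator (box a b) x *\<^sub>R g x)"
      using box by (intro Bochner_Integration.integral_cong) (auto simp: indicator_def)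
    also have "\<dots> = (LINT x|lebesgue_on (box a b). g x)"
      by (simp add: integral_restrict_space)
    finally show ?thesis .
  qed
  also have "\<dots> = integral (box a b) g"
  proof (rule lebesgue_integral_eq_integral)
    show "integrable (lebesgue_on (box a b)) g"
      using set_integrable_subset [of lebesgue \<Omega> g "box a b"] assms(1,2) box
      by (simp add: set_integrable_def integrable_restrict_space)
  qed auto
  also have "\<dots> = integral (cbox a b) g"
    by (simp add: integral_open_interval)
  finally show ?thesis using zero by simp
qed

text \<open>Lebesgue differentiation: outside a null set the value at x is the limit of averages
  over cubes with corner x. Since \<open>\<Omega>\<close> is open, small cubes lie inside it and
  have average 0.\<close>

lemma AE_eq_0_if_orthogonal_to_test_functions:
  fixes g :: "real ^ 'n \<Rightarrow> real"
  assumes "open \<Omega>" "integrable (lebesgue_on \<Omega>) g"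
    and orth: "\<And>\<psi>. \<psi> \<in> test_functions \<Omega> \<Longrightarrow> (LINT x|lebesgue_on \<Omega>. g x * \<psi> x) = 0"
  shows "AE x in lebesgue_on \<Omega>. g x = 0"
proof -
  have \<Omega>: "\<Omega> \<in> sets lebesgue" using assms by auto
  define G where "G = (\<lambda>x. if x \<in> \<Omega> then g x else 0)"
  have G: "integrable lebesgue G"
    using assms(2) Lebesgue_Measure.integrable_restrict_UNIV [OF \<Omega>, of g] by (simp add: G_def)
  have "G integrable_on cbox a b" for a b
    using integrable_on_subcbox [OF integrable_on_lebesgue [OF G] subset_UNIV] .
  then obtain N where N: "negligible N"
    "\<And>x e. \<lbrakk>x \<notin> N; 0 < e\<rbrakk> \<Longrightarrow> \<exists>d>0. \<forall>h. 0 < h \<and> h < d \<longrightarrow>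
        norm (integral (cbox x (x + h *\<^sub>R One)) G /\<^sub>R h ^ DIM(real ^ 'n) - G x) < e"
    using integrable_ccontinuous_explicit [of G] by metis
  have "g x = 0" if x: "x \<in> \<Omega>" "x \<notin> N" for x
  proof (rule ccontr)
    assume "g x \<noteq> 0"
    then have "0 < norm (G x)" using x by (simp add: G_def)
    \<comment> \<open>With the tolerance \<open>norm (G x)\<close>, an average equal to 0 would be
      at distance less than \<open>norm (G x)\<close> from \<open>G x\<close>, which is
      absurd.\<close>
    with N(2) [OF x(2)] obtain d where d: "d > 0" "\<And>h. 0 < h \<and> h < d \<Longrightarrow>
        norm (integral (cbox x (x + h *\<^sub>R One)) G /\<^sub>R h ^ DIM(real ^ 'n) - G x) < norm (G x)"
      by meson
    obtain e where e: "e > 0" "ball x e \<subseteq> \<Omega>"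
      using assms x openE by blast
    \<comment> \<open>The cube of side h has diagonal \<open>h * norm One\<close>, so this choice
      keeps it within distance e/2 of x while h stays below d. The added 1 makes the denominator
      visibly positive.\<close>
    define h where "h = min (d / 2) (e / 2 / (norm (One :: real ^ 'n) + 1))"
    have pos: "0 < norm (One :: real ^ 'n) + 1"
      by (simp add: add_nonneg_pos)
    have h: "0 < h" "h < d" "h \<le> e / 2 / (norm (One :: real ^ 'n) + 1)"
      using d e pos by (auto simp: h_def)
    have "cbox x (x + h *\<^sub>R One) \<subseteq> \<Omega>"
    proof
      fix y assume y: "y \<in> cbox x (x + h *\<^sub>R One)"
      have "norm (y - x) \<le> norm (h *\<^sub>R One :: real ^ 'n)"
        using y h by (intro norm_le_componentwise) (auto simp: mem_box inner_simps abs_le_iff)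
      also have "\<dots> = h * norm (One :: real ^ 'n)" using h by simp
      also have "\<dots> \<le> h * (norm (One :: real ^ 'n) + 1)" using h by simp
      also have "\<dots> \<le> e / 2" using h pos by (simp add: field_simps)
      finally show "y \<in> \<Omega>" using e by (auto simp: dist_norm norm_minus_commute)
    qed
    then have "integral (cbox x (x + h *\<^sub>R One)) g = 0"
      using integral_box_eq_0_if_orthogonal_to_test_functions [OF \<Omega> assms(2)] orth by blast
    moreover have "integral (cbox x (x + h *\<^sub>R One)) G = integral (cbox x (x + h *\<^sub>R One)) g"
      using \<open>cbox x (x + h *\<^sub>R One) \<subseteq> \<Omega>\<close> by (intro integral_cong) (auto simp: G_def)
    ultimately show False using d(2) [of h] h by simp
  qed
  then have "{x \<in> \<Omega>. g x \<noteq> 0} \<subseteq> N" by blast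
  then have "AE x in lebesgue. x \<in> \<Omega> \<longrightarrow> g x = 0"
    using N(1) by (intro AE_I' [of N]) (auto simp: negligible_iff_null_sets)
  then show ?thesis using \<Omega> by (simp add: AE_restrict_space_iff)
qed

section \<open>Uniqueness and linearity of weak gradients\<close>

section \<open>Weak gradients\<close>

text \<open>Here boundedness of \<open>\<Omega>\<close> enters: its closure is compact, so h is
  bounded on it, and its measure is finite. This serves test functions, their partial derivatives
  and the constant 1.\<close>

lemma continuous_in_L2_space:
  fixes h :: "real ^ 'n \<Rightarrow> 'b::euclidean_space"
  assumes "open \<Omega>" "bounded \<Omega>" "continuous_on UNIV h"
  shows "h \<in> L2_space \<Omega>"
proof -
  have meas: "h \<in> borel_measurable (lebesgue_on \<Omega>)"
    using assms
    by (intro measurable_restrict_space1 measurable_completion)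
       (simp add: borel_measurable_continuous_onI)
  have "compact (h ` closure \<Omega>)"
    using assms by (intro compact_continuous_image) (auto intro: continuous_on_subset simp: compact_closure)
  then obtain B where B: "\<And>x. x \<in> closure \<Omega> \<Longrightarrow> norm (h x) \<le> B"
    using compact_imp_bounded bounded_iff by (metis imageI)
  have "\<Omega> \<in> lmeasurable"
    using assms by (simp add: lmeasurable_open)
  then have fin: "finite_measure (lebesgue_on \<Omega>)"
    by (rule finite_measure_lebesgue_on)
  have "integrable (lebesgue_on \<Omega>) (\<lambda>x. (norm (h x))\<^sup>2)"
  proof (rule finite_measure.integrable_const_bound [OF fin, where B = "B\<^sup>2"])
    show "AE x in lebesgue_on \<Omega>. norm ((norm (h x))\<^sup>2) \<le> B\<^sup>2"
      using B closure_subset [of \<Omega>] by (intro AE_I2) (auto intro!: power_mono)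
  qed (use meas in measurable)
  with meas show ?thesis by (simp add: L2_space_def)
qed

lemma test_function_continuous:
  assumes "\<psi> \<in> test_functions \<Omega>"
  shows "continuous_on UNIV \<psi>" "continuous_on UNIV (\<lambda>x. classical_grad \<psi> x $ i)"
proof -
  have "k_times_cont_diff 0 \<psi>" "k_times_cont_diff (Suc 0) \<psi>"
    using assms unfolding test_functions_def by blast+
  then show "continuous_on UNIV \<psi>" "continuous_on UNIV (\<lambda>x. classical_grad \<psi> x $ i)"
    by auto
qed

lemma test_function_L2_space:
  assumes "open \<Omega>" "bounded \<Omega>" "\<psi> \<in> test_functions \<Omega>"
  shows "\<psi> \<in> L2_space \<Omega>" "(\<lambda>x. classical_grad \<psi> x $ i) \<in> L2_space \<Omega>"
  by (rule continuous_in_L2_space [OF assms(1,2)], rule test_function_continuous [OF assms(3)])+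

lemma L2_space_nth:
  fixes g :: "real ^ 'n \<Rightarrow> real ^ 'm"
  assumes "g \<in> L2_space \<Omega>"
  shows "(\<lambda>x. g x $ i) \<in> L2_space \<Omega>"
proof -
  have meas: "(\<lambda>x. g x $ i) \<in> borel_measurable (lebesgue_on \<Omega>)"
  proof -
    have "(\<lambda>x. inner (g x) (axis i 1)) \<in> borel_measurable (lebesgue_on \<Omega>)"
      using assms by (auto simp: L2_space_def)
    then show ?thesis by (simp add: inner_axis)
  qed
  have "integrable (lebesgue_on \<Omega>) (\<lambda>x. (norm (g x $ i))\<^sup>2)"
  proof (rule Bochner_Integration.integrable_bound)
    show "integrable (lebesgue_on \<Omega>) (\<lambda>x. (norm (g x))\<^sup>2)"
      using assms by (simp add: L2_space_def)
    show "AE x in lebesgue_on \<Omega>. norm ((norm (g x $ i))\<^sup>2) \<le> norm ((norm (g x))\<^sup>2)"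
      by (rule AE_I2) (simp add: abs_le_square_iff [symmetric] component_le_norm_cart)
  qed (use meas in measurable)
  with meas show ?thesis by (simp add: L2_space_def)
qed

lemma L2_space_integrable_mult:
  fixes w z :: "real ^ 'n \<Rightarrow> real"
  assumes "w \<in> L2_space \<Omega>" "z \<in> L2_space \<Omega>"
  shows "integrable (lebesgue_on \<Omega>) (\<lambda>x. w x * z x)"
  using L2_space_integrable_inner [OF assms] by simp

text \<open>Membership in \<open>L2_span\<close> and the choice made by \<open>L2_proj\<close> fix a
  function only almost everywhere, so gradients of combinations of modes have to be carried over to
  other representatives.\<close>

lemma is_weak_grad_cong_AE:
  assumes "open \<Omega>" "bounded \<Omega>" "is_weak_grad \<Omega> w g" "AE x in lebesgue_on \<Omega>. w x = w' x"
  shows "is_weak_grad \<Omega> w' g"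
proof -
  have w: "w \<in> L2_space \<Omega>" using assms by (simp add: is_weak_grad_def)
  have w': "w' \<in> L2_space \<Omega>"
    by (rule L2_space_cong_AE [OF _ w assms(4)]) (use assms(1) in auto)
  have eq: "(LINT x|lebesgue_on \<Omega>. w x * classical_grad \<psi> x $ i) =
      (LINT x|lebesgue_on \<Omega>. w' x * classical_grad \<psi> x $ i)" if "\<psi> \<in> test_functions \<Omega>" for \<psi> i
  proof (rule integral_cong_AE)
    have \<psi>: "(\<lambda>x. classical_grad \<psi> x $ i) \<in> L2_space \<Omega>"
      by (rule test_function_L2_space [OF assms(1,2) that])
    show "(\<lambda>x. w x * classical_grad \<psi> x $ i) \<in> borel_measurable (lebesgue_on \<Omega>)"
      "(\<lambda>x. w' x * classical_grad \<psi> x $ i) \<in> borel_measurable (lebesgue_on \<Omega>)"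
      using L2_space_integrable_mult [OF w \<psi>] L2_space_integrable_mult [OF w' \<psi>]
      by (auto intro: borel_measurable_integrable)
    show "AE x in lebesgue_on \<Omega>. w x * classical_grad \<psi> x $ i = w' x * classical_grad \<psi> x $ i"
      using assms(4) by eventually_elim simp
  qed
  show ?thesis
    unfolding is_weak_grad_def
  proof (intro conjI ballI allI)
    show "g \<in> L2_space \<Omega>" using assms(3) by (simp add: is_weak_grad_def)
    show "(LINT x|lebesgue_on \<Omega>. w' x * classical_grad \<psi> x $ i) =
        - (LINT x|lebesgue_on \<Omega>. g x $ i * \<psi> x)" if "\<psi> \<in> test_functions \<Omega>" for \<psi> i
      using assms(3) that unfolding eq [OF that, symmetric] is_weak_grad_def by blast
  qed (rule w')
qed

text \<open>Both candidates satisfy the same integration by parts formula, so each component of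
  their difference is orthogonal to all test functions.\<close>

lemma is_weak_grad_unique:
  fixes \<Omega> :: "(real ^ 'n) set"
  assumes "open \<Omega>" "bounded \<Omega>" "is_weak_grad \<Omega> w g" "is_weak_grad \<Omega> w g'"
  shows "AE x in lebesgue_on \<Omega>. g x = g' x"
proof -
  have g: "g \<in> L2_space \<Omega>" "g' \<in> L2_space \<Omega>"
    using assms by (simp_all add: is_weak_grad_def)
  have "AE x in lebesgue_on \<Omega>. g x $ i - g' x $ i = 0" for i
  proof (rule AE_eq_0_if_orthogonal_to_test_functions [OF assms(1)])
    \<comment> \<open>Multiplication by the square integrable constant 1 turns square integrability
      of the difference into integrability.\<close>
    have "(\<lambda>x. 1::real) \<in> L2_space \<Omega>"
      by (rule continuous_in_L2_space [OF assms(1,2)]) simp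
    from L2_space_integrable_mult [OF L2_space_diff [OF L2_space_nth [OF g(1)] L2_space_nth [OF g(2)]] this]
    show "integrable (lebesgue_on \<Omega>) (\<lambda>x. g x $ i - g' x $ i)"
      by simp
    fix \<psi> assume \<psi>: "\<psi> \<in> test_functions \<Omega>"
    have \<psi>2: "\<psi> \<in> L2_space \<Omega>"
      by (rule test_function_L2_space [OF assms(1,2) \<psi>])
    have "(LINT x|lebesgue_on \<Omega>. w x * classical_grad \<psi> x $ i) = - (LINT x|lebesgue_on \<Omega>. g x $ i * \<psi> x)"
      "(LINT x|lebesgue_on \<Omega>. w x * classical_grad \<psi> x $ i) = - (LINT x|lebesgue_on \<Omega>. g' x $ i * \<psi> x)"
      using assms(3,4) \<psi> unfolding is_weak_grad_def by blast+
    then show "(LINT x|lebesgue_on \<Omega>. (g x $ i - g' x $ i) * \<psi> x) = 0"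
      by (simp add: left_diff_distrib L2_space_integrable_mult L2_space_nth g \<psi>2)
  qed
  then have "AE x in lebesgue_on \<Omega>. \<forall>i\<in>UNIV. g x $ i - g' x $ i = 0"
    by (intro AE_finite_allI) auto
  then show ?thesis by eventually_elim (simp add: Finite_Cartesian_Product.vec_eq_iff)
qed

lemma is_weak_grad_add:
  assumes "open \<Omega>" "bounded \<Omega>" "is_weak_grad \<Omega> w g" "is_weak_grad \<Omega> z h"
  shows "is_weak_grad \<Omega> (\<lambda>x. w x + z x) (\<lambda>x. g x + h x)"
proof -
  have L2: "w \<in> L2_space \<Omega>" "z \<in> L2_space \<Omega>" "g \<in> L2_space \<Omega>" "h \<in> L2_space \<Omega>"
    using assms by (simp_all add: is_weak_grad_def)
  have "(LINT x|lebesgue_on \<Omega>. (w x + z x) * classical_grad \<psi> x $ i) =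
      - (LINT x|lebesgue_on \<Omega>. (g x + h x) $ i * \<psi> x)" if \<psi>: "\<psi> \<in> test_functions \<Omega>" for \<psi> i
  proof -
    have \<psi>2: "\<psi> \<in> L2_space \<Omega>" "(\<lambda>x. classical_grad \<psi> x $ i) \<in> L2_space \<Omega>"
      using test_function_L2_space [OF assms(1,2) \<psi>] by blast+
    have "(LINT x|lebesgue_on \<Omega>. w x * classical_grad \<psi> x $ i) = - (LINT x|lebesgue_on \<Omega>. g x $ i * \<psi> x)"
      "(LINT x|lebesgue_on \<Omega>. z x * classical_grad \<psi> x $ i) = - (LINT x|lebesgue_on \<Omega>. h x $ i * \<psi> x)"
      using assms(3,4) \<psi> unfolding is_weak_grad_def by blast+
    then show ?thesis
      by (simp add: distrib_right L2_space_integrable_mult L2_space_nth L2 \<psi>2)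
  qed
  then show ?thesis
    using L2 unfolding is_weak_grad_def by (blast intro: L2_space_add)
qed

lemma is_weak_grad_scale:
  assumes "is_weak_grad \<Omega> w g"
  shows "is_weak_grad \<Omega> (\<lambda>x. c * w x) (\<lambda>x. c *\<^sub>R g x)"
  using assms L2_space_scaleR [of w \<Omega> c] L2_space_scaleR [of g \<Omega> c]
  by (simp add: is_weak_grad_def mult.assoc)

lemma is_weak_grad_zero: "is_weak_grad \<Omega> (\<lambda>x. 0) (\<lambda>x. 0)"
  by (simp add: is_weak_grad_def L2_space_zero)

lemma is_weak_grad_diff:
  assumes "open \<Omega>" "bounded \<Omega>" "is_weak_grad \<Omega> w g" "is_weak_grad \<Omega> z h"
  shows "is_weak_grad \<Omega> (\<lambda>x. w x - z x) (\<lambda>x. g x - h x)"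
  using is_weak_grad_add [OF assms(1-3) is_weak_grad_scale [OF assms(4), of "-1"]] by simp

lemma is_weak_grad_sum:
  assumes "open \<Omega>" "bounded \<Omega>" "\<And>k. k \<in> I \<Longrightarrow> is_weak_grad \<Omega> (b k) (g k)"
  shows "is_weak_grad \<Omega> (\<lambda>x. \<Sum>k\<in>I. c k * b k x) (\<lambda>x. \<Sum>k\<in>I. c k *\<^sub>R g k x)"
  using assms
  by (induction I rule: infinite_finite_induct)
     (simp_all add: is_weak_grad_zero is_weak_grad_add is_weak_grad_scale)

lemma is_weak_grad_grad:
  assumes "w \<in> H1_space \<Omega>"
  shows "is_weak_grad \<Omega> w (grad \<Omega> w)"
  using assms someI_ex [of "is_weak_grad \<Omega> w"] by (simp add: H1_space_def grad_def)

lemma grad_AE_eq: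
  assumes "open \<Omega>" "bounded \<Omega>" "is_weak_grad \<Omega> w g"
  shows "AE x in lebesgue_on \<Omega>. grad \<Omega> w x = g x"
proof -
  have "w \<in> H1_space \<Omega>" using assms(3) by (auto simp: H1_space_def)
  from is_weak_grad_unique [OF assms(1,2) is_weak_grad_grad [OF this] assms(3)] show ?thesis .
qed

text \<open>\<open>grad\<close> is a choice, so it is not linear pointwise. Inside an inner product
  any weak gradient may replace it, and later gradient computations exploit linearity through this
  replacement.\<close>

lemma L2_inner_grad:
  fixes \<Omega> :: "(real ^ 'n) set"
  assumes "open \<Omega>" "bounded \<Omega>" "is_weak_grad \<Omega> w g" "is_weak_grad \<Omega> z h"
  shows "L2_inner \<Omega> (grad \<Omega> w) (grad \<Omega> z) = L2_inner \<Omega> g h"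
proof (rule L2_inner_cong_AE)
  have "w \<in> H1_space \<Omega>" "z \<in> H1_space \<Omega>" using assms by (auto simp: H1_space_def)
  then show "grad \<Omega> w \<in> L2_space \<Omega>" "grad \<Omega> z \<in> L2_space \<Omega>"
    using is_weak_grad_grad unfolding is_weak_grad_def by blast+
  show "AE x in lebesgue_on \<Omega>. grad \<Omega> w x = g x" "AE x in lebesgue_on \<Omega>. grad \<Omega> z x = h x"
    by (rule grad_AE_eq; fact)+
qed (use assms(1) in auto)

section \<open>The spectral norm and the POD modes\<close>

lemma vec_norm2_nonneg: "0 \<le> vec_norm2 x"
  by (simp add: vec_norm2_def L2_set_nonneg)

lemma vec_norm2_zero: "vec_norm2 (0\<^sub>v n) = 0"
  by (simp add: vec_norm2_def L2_set_def)

lemma vec_norm2_squared: "(vec_norm2 x)\<^sup>2 = (\<Sum>i<dim_vec x. (vec_index x i)\<^sup>2)"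
  by (simp add: vec_norm2_def L2_set_def sum_nonneg)

lemma scalar_prod_le_vec_norm2:
  assumes "dim_vec x = dim_vec y"
  shows "\<bar>scalar_prod x y\<bar> \<le> vec_norm2 x * vec_norm2 y"
proof -
  have "\<bar>scalar_prod x y\<bar> \<le> (\<Sum>i<dim_vec y. \<bar>vec_index x i\<bar> * \<bar>vec_index y i\<bar>)"
    unfolding scalar_prod_def atLeast0LessThan by (rule order_trans [OF sum_abs]) (simp add: abs_mult)
  also have "\<dots> \<le> vec_norm2 x * vec_norm2 y"
    unfolding vec_norm2_def assms by (rule L2_set_mult_ineq)
  finally show ?thesis .
qed

text \<open>A crude bound whose constant is irrelevant: it shows that the supremum in
  \<open>mat_norm2\<close> is taken over a bounded set, and it covers vectors of norm 0, for which
  the quotient carries no information.\<close>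

lemma mult_mat_vec_bounded:
  assumes "x \<in> carrier_vec (dim_col A)"
  shows "vec_norm2 (A *\<^sub>v x) \<le> (\<Sum>i<dim_row A. vec_norm2 (row A i)) * vec_norm2 x"
proof -
  have "vec_norm2 (A *\<^sub>v x) \<le> (\<Sum>i<dim_row A. \<bar>vec_index (A *\<^sub>v x) i\<bar>)"
    unfolding vec_norm2_def by (rule order_trans [OF L2_set_le_sum_abs]) simp
  also have "\<dots> \<le> (\<Sum>i<dim_row A. vec_norm2 (row A i) * vec_norm2 x)"
    using assms by (intro sum_mono) (simp add: scalar_prod_le_vec_norm2)
  finally show ?thesis by (simp add: sum_distrib_right)
qed

lemma bdd_above_mat_norm2:
  "bdd_above ((\<lambda>x. vec_norm2 (A *\<^sub>v x) / vec_norm2 x) ` carrier_vec (dim_col A))"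
proof (rule bdd_aboveI2 [where M = "\<Sum>i<dim_row A. vec_norm2 (row A i)"])
  fix x :: "real Matrix.vec" assume x: "x \<in> carrier_vec (dim_col A)"
  show "vec_norm2 (A *\<^sub>v x) / vec_norm2 x \<le> (\<Sum>i<dim_row A. vec_norm2 (row A i))"
  proof (cases "vec_norm2 x = 0")
    case True
    then show ?thesis by (simp add: sum_nonneg vec_norm2_nonneg)
  next
    case False
    then have "0 < vec_norm2 x" using vec_norm2_nonneg [of x] by simp
    then show ?thesis using mult_mat_vec_bounded [OF x] by (simp add: divide_le_eq)
  qed
qed

lemma mat_norm2_nonneg: "0 \<le> mat_norm2 A"
proof -
  \<comment> \<open>The zero vector belongs to the index set and contributes the quotient 0, by the
    convention for division by zero.\<close>
  have "vec_norm2 (A *\<^sub>v 0\<^sub>v (dim_col A)) / vec_norm2 (0\<^sub>v (dim_col A)) \<le> mat_norm2 A"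
    unfolding mat_norm2_def by (rule cSUP_upper [OF _ bdd_above_mat_norm2]) simp
  then show ?thesis by (simp add: vec_norm2_zero)
qed

lemma vec_norm2_mult_mat_vec_le:
  assumes x: "x \<in> carrier_vec (dim_col A)"
  shows "vec_norm2 (A *\<^sub>v x) \<le> mat_norm2 A * vec_norm2 x"
proof (cases "vec_norm2 x = 0")
  case True
  then show ?thesis using mult_mat_vec_bounded [OF x] by simp
next
  case False
  then have "0 < vec_norm2 x" using vec_norm2_nonneg [of x] by simp
  moreover have "vec_norm2 (A *\<^sub>v x) / vec_norm2 x \<le> mat_norm2 A"
    unfolding mat_norm2_def by (rule cSUP_upper [OF x bdd_above_mat_norm2])
  ultimately show ?thesis by (simp add: divide_le_eq)
qed

text \<open>With \<open>B\<close> the Gram matrix of the gradients of the modes, this is the inverse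
  inequality. \<open>Suc\<close> translates between matrix indices from 0 and modes numbered from
  1.\<close>

lemma quadratic_form_le_mat_norm2:
  fixes b :: "nat \<Rightarrow> real" and B :: "nat \<Rightarrow> nat \<Rightarrow> real"
  shows "(\<Sum>k\<in>{1..r}. \<Sum>l\<in>{1..r}. b k * b l * B k l) \<le>
    mat_norm2 (mat r r (\<lambda>(i, j). B (Suc i) (Suc j))) * (\<Sum>k\<in>{1..r}. (b k)\<^sup>2)"
proof -
  define S where "S = mat r r (\<lambda>(i, j). B (Suc i) (Suc j))"
  define x where "x = Matrix.vec r (\<lambda>i. b (Suc i))"
  have dims: "x \<in> carrier_vec (dim_col S)" "dim_vec x = r" "dim_row S = r" "dim_col S = r"
    by (simp_all add: S_def x_def)
  have "(\<Sum>k\<in>{1..r}. \<Sum>l\<in>{1..r}. b k * b l * B k l) = scalar_prod x (S *\<^sub>v x)"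
    by (simp add: sum.atLeast1_atMost_eq scalar_prod_def S_def x_def sum_distrib_left
        atLeast0LessThan mult_ac)
  also have "\<dots> \<le> vec_norm2 x * vec_norm2 (S *\<^sub>v x)"
    using scalar_prod_le_vec_norm2 [of x "S *\<^sub>v x"] dims by simp
  also have "\<dots> \<le> vec_norm2 x * (mat_norm2 S * vec_norm2 x)"
    by (intro mult_left_mono vec_norm2_mult_mat_vec_le dims vec_norm2_nonneg)
  also have "\<dots> = mat_norm2 S * (\<Sum>k\<in>{1..r}. (b k)\<^sup>2)"
    using vec_norm2_squared [of x]
    by (simp add: power2_eq_square x_def sum.atLeast1_atMost_eq)
  finally show ?thesis unfolding S_def .
qed

section \<open>Expansions in the POD modes\<close>

text \<open>Since \<open>snapshot_matrix\<close> carries the factor \<open>1 / M\<close> while \<open>pod_mode\<close> does not, the modes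
  have squared norm \<open>M\<close> rather than 1.\<close>

lemma pod_mode_orthogonal:
  fixes s :: "nat \<Rightarrow> real ^ 'n \<Rightarrow> real"
  assumes s: "\<And>j. j < M \<Longrightarrow> s j \<in> L2_space \<Omega>"
    and eig: "ordered_eigenpairs (snapshot_matrix \<Omega> M s) d lam v"
    and kl: "k \<in> {1..d}" "l \<in> {1..d}"
  shows "L2_inner \<Omega> (pod_mode M s lam v k) (pod_mode M s lam v l) = (if k = l then real M else 0)"
proof -
  define K where "K = snapshot_matrix \<Omega> M s"
  define c where "c = (\<lambda>k j. lam k powr (- 1 / 2) * vec_index (v k) j)"
  have lam: "lam k > 0" "lam l > 0" and ev: "eigenvector K (v k) (lam k)" "eigenvector K (v l) (lam l)"
    and orth: "scalar_prod (v k) (v l) = (if k = l then 1 else 0)"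
    using eig kl unfolding ordered_eigenpairs_def K_def by blast+
  have dim: "dim_row K = M" "dim_vec (v k) = M" "dim_vec (v l) = M"
    and Kv: "K *\<^sub>v v l = lam l \<cdot>\<^sub>v v l"
    using ev by (auto simp: eigenvector_def K_def snapshot_matrix_def)
  \<comment> \<open>Row i of the eigenvector equation, multiplied by M to clear the factor 1/M of
    the snapshot matrix; this is where the squared norm M comes from.\<close>
  have row_sum: "(\<Sum>j<M. vec_index (v l) j * L2_inner \<Omega> (s i) (s j)) = real M * (lam l * vec_index (v l) i)"
    if i: "i < M" for i
  proof -
    have "lam l * vec_index (v l) i = vec_index (K *\<^sub>v v l) i"
      using Kv i dim by simp
    also have "\<dots> = (\<Sum>j<M. 1 / real M * L2_inner \<Omega> (s j) (s i) * vec_index (v l) j)"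
      using i dim by (simp add: K_def snapshot_matrix_def scalar_prod_def atLeast0LessThan)
    also have "\<dots> = (\<Sum>j<M. vec_index (v l) j * L2_inner \<Omega> (s i) (s j)) / real M"
      by (simp add: sum_divide_distrib L2_inner_commute [of \<Omega> _ "s i"] mult.commute)
    finally show ?thesis using i by simp
  qed
  have mode: "pod_mode M s lam v k = (\<lambda>x. \<Sum>j<M. c k j *\<^sub>R s j x)" for k
    by (simp add: pod_mode_def c_def sum_distrib_left mult.assoc)
  have "L2_inner \<Omega> (pod_mode M s lam v k) (pod_mode M s lam v l) =
      (\<Sum>i<M. c k i * L2_inner \<Omega> (s i) (\<lambda>x. \<Sum>j<M. c l j *\<^sub>R s j x))"
    unfolding mode by (intro L2_inner_sum_left L2_space_sum) (use s in auto)
  also have "\<dots> = (\<Sum>i<M. c k i * (\<Sum>j<M. c l j * L2_inner \<Omega> (s i) (s j)))"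
    by (intro sum.cong refl arg_cong2 [where f = times] L2_inner_sum_right) (use s in auto)
  also have "\<dots> = (\<Sum>i<M. c k i * (lam l powr (- 1 / 2) * (real M * (lam l * vec_index (v l) i))))"
    by (intro sum.cong refl) (simp add: row_sum [symmetric] c_def sum_distrib_left mult.assoc)
  \<comment> \<open>For k = l the two powers cancel the eigenvalue; for distinct indices the
    orthogonality of the eigenvectors makes the product vanish.\<close>
  also have "\<dots> = real M * (lam k powr (- 1 / 2) * (lam l powr (- 1 / 2) * lam l)) * scalar_prod (v k) (v l)"
    using dim by (simp add: scalar_prod_def c_def sum_distrib_left atLeast0LessThan mult_ac)
  also have "\<dots> = (if k = l then real M else 0)"
  proof (cases "k = l")
    case True
    have "lam l powr (- 1 / 2) * (lam l powr (- 1 / 2) * lam l) = 1"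
      using lam by (simp add: powr_minus powr_half_sqrt field_simps)
    then show ?thesis using orth True by simp
  qed (use orth in simp)
  finally show ?thesis .
qed

text \<open>Pairing a combination with \<open>b l\<close> isolates its coefficient, up to the factor
  m. The gain is an explicit dependence on \<open>w\<close>, in place of coefficients that merely
  exist for each \<open>w\<close> separately.\<close>

lemma L2_span_coefficients:
  assumes "\<Omega> \<in> sets lebesgue" "finite I" "m > 0"
    and "\<And>k. k \<in> I \<Longrightarrow> b k \<in> L2_space \<Omega>"
    and orth: "\<And>k l. k \<in> I \<Longrightarrow> l \<in> I \<Longrightarrow> L2_inner \<Omega> (b k) (b l) = (if k = l then m else 0)"
    and w: "w \<in> L2_span \<Omega> b I"
  shows "AE x in lebesgue_on \<Omega>. w x = (\<Sum>k\<in>I. (L2_inner \<Omega> w (b k) / m) * b k x)"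
proof -
  obtain c where c: "AE x in lebesgue_on \<Omega>. w x = (\<Sum>k\<in>I. c k * b k x)"
    using w by (auto simp: L2_span_def)
  have sum: "(\<lambda>x. \<Sum>k\<in>I. c k * b k x) \<in> L2_space \<Omega>"
    using L2_space_sum [of I b \<Omega> c] assms by simp
  have "L2_inner \<Omega> w (b l) = c l * m" if l: "l \<in> I" for l
  proof -
    have "L2_inner \<Omega> w (b l) = L2_inner \<Omega> (\<lambda>x. \<Sum>k\<in>I. c k * b k x) (b l)"
      by (rule L2_inner_cong_AE [OF assms(1), symmetric, OF sum]) (use assms l c in auto)
    also have "\<dots> = (\<Sum>k\<in>I. c k * L2_inner \<Omega> (b k) (b l))"
      using L2_inner_sum_left [of "b l" \<Omega> I b c] assms l by simp
    also have "\<dots> = (\<Sum>k\<in>I. if k = l then c k * m else 0)"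
      using l by (intro sum.cong refl) (simp add: orth)
    finally show ?thesis using l assms by simp
  qed
  then have "(\<Sum>k\<in>I. (L2_inner \<Omega> w (b k) / m) * b k x) = (\<Sum>k\<in>I. c k * b k x)" for x
    using assms by (intro sum.cong refl) simp
  with c show ?thesis by simp
qed

text \<open>\<open>L2_proj\<close> is a choice, so a projection must be exhibited before its
  property can be used: the sum \<open>q\<close> is the witness. Whatever is chosen has the same
  pairings with the family as \<open>w\<close>, hence the coefficients of \<open>q\<close>.\<close>

lemma L2_proj_coefficients:
  assumes "\<Omega> \<in> sets lebesgue" "finite I" "m > 0"
    and b: "\<And>k. k \<in> I \<Longrightarrow> b k \<in> L2_space \<Omega>"
    and orth: "\<And>k l. k \<in> I \<Longrightarrow> l \<in> I \<Longrightarrow> L2_inner \<Omega> (b k) (b l) = (if k = l then m else 0)"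
    and w: "w \<in> L2_space \<Omega>"
  shows "AE x in lebesgue_on \<Omega>. L2_proj \<Omega> (L2_span \<Omega> b I) w x =
      (\<Sum>k\<in>I. (L2_inner \<Omega> w (b k) / m) * b k x)"
proof -
  let ?Y = "L2_span \<Omega> b I"
  define a where "a = (\<lambda>k. L2_inner \<Omega> w (b k) / m)"
  define q where "q = (\<lambda>x. \<Sum>k\<in>I. a k * b k x)"
  have comb: "(\<lambda>x. \<Sum>k\<in>I. c k * b k x) \<in> L2_space \<Omega>" for c
    using L2_space_sum [of I b \<Omega> c] b by simp
  have span_L2: "z \<in> L2_space \<Omega>" if "z \<in> ?Y" for z
  proof -
    obtain c where c: "AE x in lebesgue_on \<Omega>. z x = (\<Sum>k\<in>I. c k * b k x)"
      using \<open>z \<in> ?Y\<close> by (auto simp: L2_span_def)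
    show ?thesis
      by (rule L2_space_cong_AE [OF assms(1) comb [of c]]) (use c in \<open>simp add: eq_commute\<close>)
  qed
  have b_in: "b l \<in> ?Y" if "l \<in> I" for l
  proof -
    have "b l x = (\<Sum>k\<in>I. (if k = l then 1 else 0) * b k x)" for x
      using that assms(2) by (simp add: if_distrib [where f = "\<lambda>c. c * _"] cong: if_cong)
    then show ?thesis
      unfolding L2_span_def by (intro CollectI exI [of _ "\<lambda>k. if k = l then 1 else 0"] AE_I2)
  qed
  have q: "q \<in> ?Y" "q \<in> L2_space \<Omega>"
    unfolding q_def by (auto simp: L2_span_def comb)
  have "\<exists>p. p \<in> ?Y \<and> (\<forall>z\<in>?Y. L2_inner \<Omega> (\<lambda>x. w x - p x) z = 0)"
  proof (intro exI [of _ q] conjI ballI q)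
    fix z assume "z \<in> ?Y"
    then obtain c where c: "AE x in lebesgue_on \<Omega>. z x = (\<Sum>k\<in>I. c k * b k x)"
      by (auto simp: L2_span_def)
    have wq: "(\<lambda>x. w x - q x) \<in> L2_space \<Omega>" by (intro L2_space_diff w q)
    have "L2_inner \<Omega> (\<lambda>x. w x - q x) (b l) = 0" if l: "l \<in> I" for l
    proof -
      have "L2_inner \<Omega> q (b l) = (\<Sum>k\<in>I. a k * L2_inner \<Omega> (b k) (b l))"
        using L2_inner_sum_left [of "b l" \<Omega> I b a] b l
        by (simp add: q_def)
      also have "\<dots> = (\<Sum>k\<in>I. if k = l then L2_inner \<Omega> w (b k) else 0)"
        using l assms(3) by (intro sum.cong refl) (simp add: orth a_def)
      finally show ?thesis using l assms(2) by (simp add: L2_inner_diff_left w q b)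
    qed
    then have "L2_inner \<Omega> (\<lambda>x. w x - q x) (\<lambda>x. \<Sum>k\<in>I. c k * b k x) = 0"
      using L2_inner_sum_right [OF wq, of I b c] b by simp
    moreover have "L2_inner \<Omega> (\<lambda>x. w x - q x) z = L2_inner \<Omega> (\<lambda>x. w x - q x) (\<lambda>x. \<Sum>k\<in>I. c k * b k x)"
      by (rule L2_inner_cong_AE [OF assms(1) wq span_L2 [OF \<open>z \<in> ?Y\<close>] _ c]) simp
    ultimately show "L2_inner \<Omega> (\<lambda>x. w x - q x) z = 0" by simp
  qed
  then have "L2_proj \<Omega> ?Y w \<in> ?Y \<and> (\<forall>z\<in>?Y. L2_inner \<Omega> (\<lambda>x. w x - L2_proj \<Omega> ?Y w x) z = 0)"
    unfolding L2_proj_def by (rule someI_ex)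
  then have p: "L2_proj \<Omega> ?Y w \<in> ?Y" "\<And>z. z \<in> ?Y \<Longrightarrow> L2_inner \<Omega> (\<lambda>x. w x - L2_proj \<Omega> ?Y w x) z = 0"
    by blast+
  have "L2_inner \<Omega> (L2_proj \<Omega> ?Y w) (b l) = L2_inner \<Omega> w (b l)" if "l \<in> I" for l
    using p(2) [OF b_in [OF that]] that by (simp add: L2_inner_diff_left w b span_L2 p(1))
  then have "(\<Sum>k\<in>I. (L2_inner \<Omega> (L2_proj \<Omega> ?Y w) (b k) / m) * b k x) = q x" for x
    unfolding q_def a_def by (intro sum.cong refl) simp
  then show ?thesis
    using L2_span_coefficients [OF assms(1-3) b orth p(1)] by (simp add: q_def a_def)
qed

section \<open>Time derivatives of the coefficients and the error estimate\<close>

section \<open>The error equation\<close>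

lemma H1_space_imp_L2_space: "w \<in> H1_space \<Omega> \<Longrightarrow> w \<in> L2_space \<Omega>"
  by (auto simp: H1_space_def is_weak_grad_def)

lemma H10_space_imp_H1_space: "w \<in> H10_space \<Omega> \<Longrightarrow> w \<in> H1_space \<Omega>"
  by (simp add: H10_space_def)

lemma grad_L2_space: "w \<in> H1_space \<Omega> \<Longrightarrow> grad \<Omega> w \<in> L2_space \<Omega>"
  using is_weak_grad_grad unfolding is_weak_grad_def by blast

lemma L2_norm_le_H1_norm: "L2_norm \<Omega> w \<le> H1_norm \<Omega> w"
  unfolding H1_norm_def by (rule real_le_rsqrt) simp

text \<open>Pairing with a fixed \<open>z\<close> is linear and, by Cauchy-Schwarz, bounded in the
  H1 norm, so it commutes with the limit of difference quotients.\<close>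

lemma L2_inner_has_time_derivative:
  fixes \<Omega> :: "(real ^ 'n) set"
  assumes "C1_into \<Omega> Y T w w'" "Y \<subseteq> L2_space \<Omega>" "z \<in> L2_space \<Omega>" "t \<in> {0..T}"
  shows "((\<lambda>\<tau>. L2_inner \<Omega> (w \<tau>) z) has_real_derivative L2_inner \<Omega> (w' t) z) (at t within {0..T})"
proof -
  have L2: "w \<tau> \<in> L2_space \<Omega>" "w' \<tau> \<in> L2_space \<Omega>" if "\<tau> \<in> {0..T}" for \<tau>
    using assms that unfolding C1_into_def by blast+
  have lim: "((\<lambda>\<tau>. H1_norm \<Omega> (\<lambda>x. (w \<tau> x - w t x) / (\<tau> - t) - w' t x)) \<longlongrightarrow> 0) (at t within {0..T})"
    using assms unfolding C1_into_def by blast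
  have "\<forall>\<^sub>F \<tau> in at t within {0..T}. norm ((L2_inner \<Omega> (w \<tau>) z - L2_inner \<Omega> (w t) z) / (\<tau> - t) - L2_inner \<Omega> (w' t) z)
      \<le> H1_norm \<Omega> (\<lambda>x. (w \<tau> x - w t x) / (\<tau> - t) - w' t x) * L2_norm \<Omega> z"
    unfolding eventually_at_filter
  proof (intro always_eventually allI impI)
    fix \<tau> assume \<tau>: "\<tau> \<noteq> t" "\<tau> \<in> {0..T}"
    let ?e = "\<lambda>x. (1 / (\<tau> - t)) *\<^sub>R (w \<tau> x - w t x) - w' t x"
    have q: "(\<lambda>x. w \<tau> x - w t x) \<in> L2_space \<Omega>"
      by (intro L2_space_diff L2 \<tau> assms(4))
    have e: "?e \<in> L2_space \<Omega>"
      by (intro L2_space_diff L2_space_scaleR q L2 assms(4))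
    have "L2_inner \<Omega> ?e z = (1 / (\<tau> - t)) * (L2_inner \<Omega> (w \<tau>) z - L2_inner \<Omega> (w t) z) - L2_inner \<Omega> (w' t) z"
      using L2_inner_diff_left [OF assms(3) L2_space_scaleR [OF q, of "1 / (\<tau> - t)"] L2(2) [OF assms(4)]]
        L2_inner_scaleR_right [of \<Omega> z "1 / (\<tau> - t)" "\<lambda>x. w \<tau> x - w t x"]
        L2_inner_diff_left [OF assms(3) L2(1) [OF \<tau>(2)] L2(1) [OF assms(4)]]
      by (simp add: L2_inner_commute [of \<Omega> z])
    moreover have "\<bar>L2_inner \<Omega> ?e z\<bar> \<le> H1_norm \<Omega> ?e * L2_norm \<Omega> z"
      by (rule order_trans [OF L2_Cauchy_Schwarz [OF e assms(3)]])
         (intro mult_right_mono L2_norm_le_H1_norm L2_norm_nonneg)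
    ultimately show "norm ((L2_inner \<Omega> (w \<tau>) z - L2_inner \<Omega> (w t) z) / (\<tau> - t) - L2_inner \<Omega> (w' t) z)
        \<le> H1_norm \<Omega> (\<lambda>x. (w \<tau> x - w t x) / (\<tau> - t) - w' t x) * L2_norm \<Omega> z"
      by simp
  qed
  moreover have "((\<lambda>\<tau>. H1_norm \<Omega> (\<lambda>x. (w \<tau> x - w t x) / (\<tau> - t) - w' t x) * L2_norm \<Omega> z) \<longlongrightarrow> 0) (at t within {0..T})"
    using tendsto_mult_left_zero [OF lim] .
  ultimately have "((\<lambda>\<tau>. (L2_inner \<Omega> (w \<tau>) z - L2_inner \<Omega> (w t) z) / (\<tau> - t) - L2_inner \<Omega> (w' t) z) \<longlongrightarrow> 0) (at t within {0..T})"
    by (rule Lim_null_comparison)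
  then show ?thesis
    unfolding has_field_derivative_iff by (rule LIM_zero_cancel)
qed

text \<open>The product rule yields two double sums; exchanging the order of summation and the
  symmetry of \<open>B\<close> identify them, whence the factor 2.\<close>

lemma quadratic_form_has_derivative:
  fixes a :: "nat \<Rightarrow> real \<Rightarrow> real" and B :: "nat \<Rightarrow> nat \<Rightarrow> real"
  assumes a: "\<And>k. k \<in> I \<Longrightarrow> (a k has_real_derivative a' k) (at t within A)"
    and sym: "\<And>k l. B k l = B l k"
  shows "((\<lambda>\<tau>. \<Sum>k\<in>I. \<Sum>l\<in>I. a k \<tau> * a l \<tau> * B k l) has_real_derivative
    2 * (\<Sum>k\<in>I. a' k * (\<Sum>l\<in>I. a l t * B l k))) (at t within A)"
proof -
  have "((\<lambda>\<tau>. \<Sum>k\<in>I. \<Sum>l\<in>I. a k \<tau> * a l \<tau> * B k l) has_real_derivative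
      (\<Sum>k\<in>I. \<Sum>l\<in>I. (a' k * a l t + a' l * a k t) * B k l)) (at t within A)"
    by (intro DERIV_sum DERIV_cmult_right DERIV_mult a)
  also have "(\<Sum>k\<in>I. \<Sum>l\<in>I. (a' k * a l t + a' l * a k t) * B k l) =
      (\<Sum>k\<in>I. \<Sum>l\<in>I. a' k * a l t * B l k) + (\<Sum>k\<in>I. \<Sum>l\<in>I. a' l * a k t * B k l)"
    by (simp add: distrib_right sum.distrib sym [of _ "_"])
  also have "(\<Sum>k\<in>I. \<Sum>l\<in>I. a' l * a k t * B k l) = (\<Sum>k\<in>I. \<Sum>l\<in>I. a' k * a l t * B l k)"
    by (rule sum.swap)
  finally show ?thesis
    by (simp add: sum_distrib_left mult.assoc)
qed

text \<open>The heat equation may be tested with the snapshots, which lie in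
  \<open>H10_space\<close>. Linearity in the test function transfers it to the modes, for which
  membership in \<open>H1_space\<close> then suffices.\<close>

lemma weak_heat_equation_sum:
  assumes \<Omega>: "open \<Omega>" "bounded \<Omega>" and w: "w \<in> H1_space \<Omega>" "w' \<in> L2_space \<Omega>" "h \<in> L2_space \<Omega>"
    and b: "\<And>k. k \<in> I \<Longrightarrow> b k \<in> H1_space \<Omega>"
    and eq: "\<And>k. k \<in> I \<Longrightarrow> L2_inner \<Omega> w' (b k) + \<nu> * L2_inner \<Omega> (grad \<Omega> w) (grad \<Omega> (b k)) = L2_inner \<Omega> h (b k)"
  shows "L2_inner \<Omega> w' (\<lambda>x. \<Sum>k\<in>I. c k * b k x) +
      \<nu> * L2_inner \<Omega> (grad \<Omega> w) (grad \<Omega> (\<lambda>x. \<Sum>k\<in>I. c k * b k x)) =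
    L2_inner \<Omega> h (\<lambda>x. \<Sum>k\<in>I. c k * b k x)"
proof -
  have sum: "L2_inner \<Omega> y (\<lambda>x. \<Sum>k\<in>I. c k * b k x) = (\<Sum>k\<in>I. c k * L2_inner \<Omega> y (b k))"
    if "y \<in> L2_space \<Omega>" for y
    using L2_inner_sum_right [OF that, of I b c] H1_space_imp_L2_space [OF b] by simp
  have "is_weak_grad \<Omega> (\<lambda>x. \<Sum>k\<in>I. c k * b k x) (\<lambda>x. \<Sum>k\<in>I. c k *\<^sub>R grad \<Omega> (b k) x)"
    by (intro is_weak_grad_sum \<Omega> is_weak_grad_grad b)
  then have "L2_inner \<Omega> (grad \<Omega> w) (grad \<Omega> (\<lambda>x. \<Sum>k\<in>I. c k * b k x)) =
      L2_inner \<Omega> (grad \<Omega> w) (\<lambda>x. \<Sum>k\<in>I. c k *\<^sub>R grad \<Omega> (b k) x)"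
    by (rule L2_inner_grad [OF \<Omega> is_weak_grad_grad [OF w(1)]])
  also have "\<dots> = (\<Sum>k\<in>I. c k * L2_inner \<Omega> (grad \<Omega> w) (grad \<Omega> (b k)))"
    by (intro L2_inner_sum_right grad_L2_space w b)
  finally have "L2_inner \<Omega> w' (\<lambda>x. \<Sum>k\<in>I. c k * b k x) +
      \<nu> * L2_inner \<Omega> (grad \<Omega> w) (grad \<Omega> (\<lambda>x. \<Sum>k\<in>I. c k * b k x)) =
      (\<Sum>k\<in>I. c k * (L2_inner \<Omega> w' (b k) + \<nu> * L2_inner \<Omega> (grad \<Omega> w) (grad \<Omega> (b k))))"
    by (simp add: sum w sum_distrib_left distrib_left sum.distrib mult.left_commute)
  also have "\<dots> = L2_inner \<Omega> h (\<lambda>x. \<Sum>k\<in>I. c k * b k x)"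
    by (simp add: sum w eq)
  finally show ?thesis .
qed

theorem mainTheorem5:
  fixes \<Omega> :: "(real ^ 'n) set" and T \<nu> :: real
    and u u_t f u_r u_r_t :: "real \<Rightarrow> real ^ 'n \<Rightarrow> real"
    and N d r :: nat and times :: "nat \<Rightarrow> real"
    and lam :: "nat \<Rightarrow> real" and v :: "nat \<Rightarrow> real Matrix.vec"
  defines "M \<equiv> N + 1"
    and "s \<equiv> (\<lambda>j. u (times j))"
  defines "\<phi> \<equiv> pod_mode M s lam v"
  defines "Xr \<equiv> L2_span \<Omega> \<phi> {1..r}"
  defines "C \<equiv> C_inv (stiffness_matrix \<Omega> r \<phi>)"
    and "\<eta> \<equiv> (\<lambda>t x. u t x - L2_proj \<Omega> Xr (u t) x)"
    and "\<phi>\<^sub>r \<equiv> (\<lambda>t x. u_r t x - L2_proj \<Omega> Xr (u t) x)"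
  assumes "open \<Omega>" "connected \<Omega>" "\<Omega> \<noteq> {}" "bounded \<Omega>"
    and "T > 0" and "\<nu> > 0"
    and "continuous_into_L2 \<Omega> T f"
    and "solves_heat \<Omega> (H10_space \<Omega>) T \<nu> f u u_t"
    and "\<forall>j\<le>N. times j \<in> {0..T}"
    and "has_L2_dim \<Omega> (L2_span \<Omega> s {..<M}) d"
    and "ordered_eigenpairs (snapshot_matrix \<Omega> M s) d lam v"
    and "1 \<le> r" and "r \<le> d"
    and "solves_heat \<Omega> Xr T \<nu> f u_r u_r_t"
  shows "\<forall>t\<in>{0..T}. \<exists>D.
      ((\<lambda>\<tau>. (L2_norm \<Omega> (grad \<Omega> (\<phi>\<^sub>r \<tau>)))\<^sup>2) has_real_derivative D) (at t within {0..T}) \<and>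
      D \<le> \<nu> * C\<^sup>2 * (L2_norm \<Omega> (grad \<Omega> (\<eta> t)))\<^sup>2"
proof
  let ?I = "{1..r}"
  note \<Omega> = \<open>open \<Omega>\<close> \<open>bounded \<Omega>\<close>
  have \<Omega>_sets: "\<Omega> \<in> sets lebesgue" using \<Omega>(1) by auto
  have M: "0 < real M" "1 \<le> real M" by (simp_all add: M_def)
  have u_C1: "C1_into \<Omega> (H10_space \<Omega>) T u u_t"
    and u_eq: "\<And>t z. \<lbrakk>t \<in> {0..T}; z \<in> H10_space \<Omega>\<rbrakk> \<Longrightarrow>
        L2_inner \<Omega> (u_t t) z + \<nu> * L2_inner \<Omega> (grad \<Omega> (u t)) (grad \<Omega> z) = L2_inner \<Omega> (f t) z"
    using \<open>solves_heat \<Omega> (H10_space \<Omega>) T \<nu> f u u_t\<close> unfolding solves_heat_def by blast+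
  have u: "u t \<in> H10_space \<Omega>" "u_t t \<in> H10_space \<Omega>" if "t \<in> {0..T}" for t
    using u_C1 that unfolding C1_into_def by blast+
  have H1: "u t \<in> H1_space \<Omega>" "u_t t \<in> H1_space \<Omega>" if "t \<in> {0..T}" for t
    using u [OF that] by (simp_all add: H10_space_imp_H1_space)
  have ur_C1: "C1_into \<Omega> Xr T u_r u_r_t"
    and ur_eq: "\<And>t z. \<lbrakk>t \<in> {0..T}; z \<in> Xr\<rbrakk> \<Longrightarrow>
        L2_inner \<Omega> (u_r_t t) z + \<nu> * L2_inner \<Omega> (grad \<Omega> (u_r t)) (grad \<Omega> z) = L2_inner \<Omega> (f t) z"
    using \<open>solves_heat \<Omega> Xr T \<nu> f u_r u_r_t\<close> unfolding solves_heat_def by blast+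
  have ur: "u_r t \<in> Xr" "u_r_t t \<in> Xr" if "t \<in> {0..T}" for t
    using ur_C1 that unfolding C1_into_def by blast+
  have s: "s j \<in> H10_space \<Omega>" if "j < M" for j
    using u(1) \<open>\<forall>j\<le>N. times j \<in> {0..T}\<close> that by (simp add: s_def M_def)
  define c where "c = (\<lambda>k j. lam k powr (- 1 / 2) * vec_index (v k) j)"
  have \<phi>: "\<phi> k = (\<lambda>x. \<Sum>j\<in>{..<M}. c k j * s j x)" for k
    by (simp add: \<phi>_def pod_mode_def c_def sum_distrib_left mult.assoc)
  have \<phi>_H1: "\<phi> k \<in> H1_space \<Omega>" for k
  proof -
    have "is_weak_grad \<Omega> (\<phi> k) (\<lambda>x. \<Sum>j\<in>{..<M}. c k j *\<^sub>R grad \<Omega> (s j) x)"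
      unfolding \<phi> by (intro is_weak_grad_sum \<Omega> is_weak_grad_grad H10_space_imp_H1_space s) simp
    then show ?thesis by (auto simp: H1_space_def)
  qed
  have \<phi>_L2: "\<phi> k \<in> L2_space \<Omega>" for k by (intro H1_space_imp_L2_space \<phi>_H1)
  have orth: "L2_inner \<Omega> (\<phi> k) (\<phi> l) = (if k = l then real M else 0)" if "k \<in> ?I" "l \<in> ?I" for k l
    unfolding \<phi>_def
    by (rule pod_mode_orthogonal [where d = d])
       (use that \<open>r \<le> d\<close> in
         \<open>auto intro: H1_space_imp_L2_space H10_space_imp_H1_space s
            \<open>ordered_eigenpairs (snapshot_matrix \<Omega> M s) d lam v\<close>\<close>)
  define G where "G = (\<lambda>k. grad \<Omega> (\<phi> k))"
  have G: "is_weak_grad \<Omega> (\<phi> k) (G k)" for k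
    unfolding G_def by (intro is_weak_grad_grad \<phi>_H1)
  have G_eq: "grad \<Omega> (\<phi> k) = G k" for k by (simp add: G_def)
  have G_L2: "G k \<in> L2_space \<Omega>" for k
    using G by (simp add: is_weak_grad_def)
  define B where "B = (\<lambda>k l. L2_inner \<Omega> (G k) (G l))"
  have B_sym: "B k l = B l k" for k l by (simp add: B_def L2_inner_commute)
  have grad_comb: "is_weak_grad \<Omega> w (\<lambda>x. \<Sum>k\<in>?I. a k *\<^sub>R G k x)"
    if "AE x in lebesgue_on \<Omega>. w x = (\<Sum>k\<in>?I. a k * \<phi> k x)" for w a
  proof (rule is_weak_grad_cong_AE [OF \<Omega>])
    show "is_weak_grad \<Omega> (\<lambda>x. \<Sum>k\<in>?I. a k * \<phi> k x) (\<lambda>x. \<Sum>k\<in>?I. a k *\<^sub>R G k x)"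
      by (intro is_weak_grad_sum \<Omega> G)
  qed (rule eventually_mono [OF that], simp)
  have Xr_H1: "w \<in> H1_space \<Omega>" if w: "w \<in> Xr" for w
  proof -
    obtain a where "AE x in lebesgue_on \<Omega>. w x = (\<Sum>k\<in>?I. a k * \<phi> k x)"
      using w by (auto simp: Xr_def L2_span_def)
    from grad_comb [OF this] show ?thesis by (auto simp: H1_space_def)
  qed
  have \<phi>_Xr: "\<phi> l \<in> Xr" if "l \<in> ?I" for l
  proof -
    have "\<phi> l x = (\<Sum>k\<in>?I. (if k = l then 1 else 0) * \<phi> k x)" for x
      using that by (simp add: if_distrib [where f = "\<lambda>c. c * _"] cong: if_cong)
    then show ?thesis
      unfolding Xr_def L2_span_def by (intro CollectI exI [of _ "\<lambda>k. if k = l then 1 else 0"] AE_I2)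
  qed

  \<comment> \<open>These are the coefficients of \<open>\<phi>\<^sub>r\<close>, written with
    \<open>u\<close> in place of its projection: only pairings with fixed functions occur, so the
    projection is never differentiated in time.\<close>
  define a where "a = (\<lambda>k t. (L2_inner \<Omega> (u_r t) (\<phi> k) - L2_inner \<Omega> (u t) (\<phi> k)) / real M)"
  define a' where "a' = (\<lambda>k t. (L2_inner \<Omega> (u_r_t t) (\<phi> k) - L2_inner \<Omega> (u_t t) (\<phi> k)) / real M)"
  have a_deriv: "(a k has_real_derivative a' k t) (at t within {0..T})" if t: "t \<in> {0..T}" for k t
  proof -
    have "Xr \<subseteq> L2_space \<Omega>" "H10_space \<Omega> \<subseteq> L2_space \<Omega>"
      using Xr_H1 H10_space_imp_H1_space H1_space_imp_L2_space by blast+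
    with ur_C1 u_C1 show ?thesis
      unfolding a_def a'_def
      by (intro DERIV_cdivide DERIV_diff L2_inner_has_time_derivative \<phi>_L2 t)
  qed
  have proj: "AE x in lebesgue_on \<Omega>. L2_proj \<Omega> Xr (u t) x =
      (\<Sum>k\<in>?I. (L2_inner \<Omega> (u t) (\<phi> k) / real M) * \<phi> k x)" if t: "t \<in> {0..T}" for t
    unfolding Xr_def
    by (intro L2_proj_coefficients \<Omega>_sets M orth \<phi>_L2 H1_space_imp_L2_space H1 t) simp_all
  have \<phi>r_grad: "is_weak_grad \<Omega> (\<phi>\<^sub>r t) (\<lambda>x. \<Sum>k\<in>?I. a k t *\<^sub>R G k x)" if t: "t \<in> {0..T}" for t
  proof (rule grad_comb)
    have "AE x in lebesgue_on \<Omega>. u_r t x = (\<Sum>k\<in>?I. (L2_inner \<Omega> (u_r t) (\<phi> k) / real M) * \<phi> k x)"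
      using ur [OF t] unfolding Xr_def
      by (intro L2_span_coefficients \<Omega>_sets M orth \<phi>_L2) simp_all
    with proj [OF t] show "AE x in lebesgue_on \<Omega>. \<phi>\<^sub>r t x = (\<Sum>k\<in>?I. a k t * \<phi> k x)"
      by eventually_elim (simp add: \<phi>\<^sub>r_def a_def diff_divide_distrib left_diff_distrib sum_subtractf)
  qed
  have inner_\<phi>r: "L2_inner \<Omega> (grad \<Omega> (\<phi>\<^sub>r t)) (G k) = (\<Sum>l\<in>?I. a l t * B l k)" if t: "t \<in> {0..T}" for t k
  proof -
    have "L2_inner \<Omega> (grad \<Omega> (\<phi>\<^sub>r t)) (G k) = L2_inner \<Omega> (\<lambda>x. \<Sum>l\<in>?I. a l t *\<^sub>R G l x) (G k)"
      using L2_inner_grad [OF \<Omega> \<phi>r_grad [OF t] G] unfolding G_eq .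
    also have "\<dots> = (\<Sum>l\<in>?I. a l t * B l k)"
      unfolding B_def by (intro L2_inner_sum_left G_L2)
    finally show ?thesis .
  qed
  have sq: "(L2_norm \<Omega> (\<lambda>x. \<Sum>k\<in>?I. b k *\<^sub>R G k x))\<^sup>2 = (\<Sum>k\<in>?I. \<Sum>l\<in>?I. b k * b l * B k l)" for b
  proof -
    have "(L2_norm \<Omega> (\<lambda>x. \<Sum>k\<in>?I. b k *\<^sub>R G k x))\<^sup>2 =
        (\<Sum>k\<in>?I. b k * L2_inner \<Omega> (G k) (\<lambda>x. \<Sum>l\<in>?I. b l *\<^sub>R G l x))"
      unfolding L2_norm_squared by (intro L2_inner_sum_left L2_space_sum G_L2)
    also have "\<dots> = (\<Sum>k\<in>?I. b k * (\<Sum>l\<in>?I. b l * B k l))"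
      unfolding B_def by (intro sum.cong refl arg_cong2 [where f = "(*)"] L2_inner_sum_right G_L2)
    finally show ?thesis by (simp add: sum_distrib_left mult.assoc)
  qed

  fix t assume t: "t \<in> {0..T}"
  let ?D = "2 * (\<Sum>k\<in>?I. a' k t * (\<Sum>l\<in>?I. a l t * B l k))"
  define E where "E = C * L2_norm \<Omega> (grad \<Omega> (\<eta> t))"
  have deriv: "((\<lambda>\<tau>. (L2_norm \<Omega> (grad \<Omega> (\<phi>\<^sub>r \<tau>)))\<^sup>2) has_real_derivative ?D) (at t within {0..T})"
  \<comment> \<open>The norm agrees with the quadratic form on the whole time interval, so the
    radius 1 is arbitrary.\<close>
  proof (rule has_field_derivative_transform_within [where d = 1, OF _ _ t])
    show "((\<lambda>\<tau>. \<Sum>k\<in>?I. \<Sum>l\<in>?I. a k \<tau> * a l \<tau> * B k l) has_real_derivative ?D) (at t within {0..T})"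
      by (rule quadratic_form_has_derivative [OF a_deriv [OF t] B_sym])
    show "(\<Sum>k\<in>?I. \<Sum>l\<in>?I. a k \<tau> * a l \<tau> * B k l) = (L2_norm \<Omega> (grad \<Omega> (\<phi>\<^sub>r \<tau>)))\<^sup>2"
      if "\<tau> \<in> {0..T}" for \<tau>
      using L2_inner_grad [OF \<Omega> \<phi>r_grad [OF that] \<phi>r_grad [OF that]] sq [of "\<lambda>k. a k \<tau>"]
      by (simp add: L2_norm_squared)
  qed simp

  \<comment> \<open>The same weak gradient of the projection is used for \<eta> and for
    \<open>\<phi>\<^sub>r\<close>, so that it cancels in \<open>h k - q k\<close>.\<close>
  obtain p where p: "is_weak_grad \<Omega> (L2_proj \<Omega> Xr (u t)) p"
    using grad_comb [OF proj [OF t]] by blast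
  have \<eta>_grad: "is_weak_grad \<Omega> (\<eta> t) (\<lambda>x. grad \<Omega> (u t) x - p x)"
    unfolding \<eta>_def by (intro is_weak_grad_diff \<Omega> is_weak_grad_grad H1 t p)
  \<comment> \<open>A second weak gradient of \<open>\<phi>\<^sub>r\<close>: the combination of the
    \<open>G k\<close> serves differentiation in time, this one brings in the Galerkin
    equation.\<close>
  have \<phi>r_grad': "is_weak_grad \<Omega> (\<phi>\<^sub>r t) (\<lambda>x. grad \<Omega> (u_r t) x - p x)"
    unfolding \<phi>\<^sub>r_def by (intro is_weak_grad_diff \<Omega> is_weak_grad_grad Xr_H1 ur t p)
  have \<eta>_L2: "grad \<Omega> (\<eta> t) \<in> L2_space \<Omega>"
    using \<eta>_grad by (intro grad_L2_space) (auto simp: H1_space_def)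

  define h where "h = (\<lambda>k. L2_inner \<Omega> (grad \<Omega> (\<eta> t)) (G k))"
  define q where "q = (\<lambda>k. L2_inner \<Omega> (grad \<Omega> (\<phi>\<^sub>r t)) (G k))"
  have q: "q k = h k - real M / \<nu> * a' k t" if k: "k \<in> ?I" for k
  proof -
    have p_L2: "p \<in> L2_space \<Omega>" using p by (simp add: is_weak_grad_def)
    have "h k = L2_inner \<Omega> (\<lambda>x. grad \<Omega> (u t) x - p x) (G k)"
      using L2_inner_grad [OF \<Omega> \<eta>_grad G] by (simp add: h_def G_eq)
    also have "\<dots> = L2_inner \<Omega> (grad \<Omega> (u t)) (G k) - L2_inner \<Omega> p (G k)"
      by (intro L2_inner_diff_left G_L2 grad_L2_space H1 t p_L2)
    finally have h: "h k = L2_inner \<Omega> (grad \<Omega> (u t)) (G k) - L2_inner \<Omega> p (G k)" .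
    have "q k = L2_inner \<Omega> (\<lambda>x. grad \<Omega> (u_r t) x - p x) (G k)"
      using L2_inner_grad [OF \<Omega> \<phi>r_grad' G] by (simp add: q_def G_eq)
    also have "\<dots> = L2_inner \<Omega> (grad \<Omega> (u_r t)) (G k) - L2_inner \<Omega> p (G k)"
      by (intro L2_inner_diff_left G_L2 grad_L2_space Xr_H1 ur t p_L2)
    finally have q: "q k = L2_inner \<Omega> (grad \<Omega> (u_r t)) (G k) - L2_inner \<Omega> p (G k)" .
    have f: "f t \<in> L2_space \<Omega>"
      using \<open>continuous_into_L2 \<Omega> T f\<close> t by (simp add: continuous_into_L2_def)
    have "L2_inner \<Omega> (u_t t) (\<phi> k) + \<nu> * L2_inner \<Omega> (grad \<Omega> (u t)) (G k) = L2_inner \<Omega> (f t) (\<phi> k)"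
      unfolding G_def \<phi>
      by (intro weak_heat_equation_sum \<Omega> H1 t H1_space_imp_L2_space [OF H1(2)] f
          H10_space_imp_H1_space u_eq s) simp_all
    moreover have "L2_inner \<Omega> (u_r_t t) (\<phi> k) + \<nu> * L2_inner \<Omega> (grad \<Omega> (u_r t)) (G k) = L2_inner \<Omega> (f t) (\<phi> k)"
      using ur_eq [OF t \<phi>_Xr [OF k]] by (simp add: G_eq)
    moreover have "real M * a' k t = L2_inner \<Omega> (u_r_t t) (\<phi> k) - L2_inner \<Omega> (u_t t) (\<phi> k)"
      using M by (simp add: a'_def)
    ultimately have "real M * a' k t = \<nu> * (h k - q k)"
      by (simp add: h q algebra_simps)
    then show ?thesis using \<open>\<nu> > 0\<close> by (simp add: field_simps)
  qed

  define \<epsilon> where "\<epsilon> = sqrt (\<Sum>k\<in>?I. (a' k t)\<^sup>2)"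
  have \<epsilon>: "\<epsilon>\<^sup>2 = (\<Sum>k\<in>?I. (a' k t)\<^sup>2)" "0 \<le> \<epsilon>"
    by (simp_all add: \<epsilon>_def sum_nonneg)
  have C: "C\<^sup>2 = mat_norm2 (stiffness_matrix \<Omega> r \<phi>)" "0 \<le> C"
    by (simp_all add: C_def C_inv_def mat_norm2_nonneg)
  \<comment> \<open>The inverse inequality is measured by the Euclidean norm \<epsilon> of the
    coefficients; the L2 norm of the corresponding combination of modes is \<epsilon> times the
    square root of M.\<close>
  have "(L2_norm \<Omega> (\<lambda>x. \<Sum>k\<in>?I. a' k t *\<^sub>R G k x))\<^sup>2 \<le> (C * \<epsilon>)\<^sup>2"
  proof -
    have S: "stiffness_matrix \<Omega> r \<phi> = mat r r (\<lambda>(i, j). B (Suc i) (Suc j))"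
      by (simp add: stiffness_matrix_def B_def G_eq L2_inner_commute)
    show ?thesis
      unfolding sq power_mult_distrib C(1) \<epsilon>(1) S by (rule quadratic_form_le_mat_norm2)
  qed
  then have norm_le: "L2_norm \<Omega> (\<lambda>x. \<Sum>k\<in>?I. a' k t *\<^sub>R G k x) \<le> C * \<epsilon>"
    by (rule power2_le_imp_le) (intro mult_nonneg_nonneg C \<epsilon>)
  have "(\<Sum>k\<in>?I. a' k t * h k) = L2_inner \<Omega> (grad \<Omega> (\<eta> t)) (\<lambda>x. \<Sum>k\<in>?I. a' k t *\<^sub>R G k x)"
    unfolding h_def by (intro L2_inner_sum_right [symmetric] \<eta>_L2 G_L2)
  also have "\<dots> \<le> L2_norm \<Omega> (grad \<Omega> (\<eta> t)) * L2_norm \<Omega> (\<lambda>x. \<Sum>k\<in>?I. a' k t *\<^sub>R G k x)"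
    by (rule order_trans [OF abs_ge_self L2_Cauchy_Schwarz [OF \<eta>_L2 L2_space_sum [OF G_L2]]])
  also have "\<dots> \<le> L2_norm \<Omega> (grad \<Omega> (\<eta> t)) * (C * \<epsilon>)"
    by (intro mult_left_mono norm_le L2_norm_nonneg)
  finally have h_le: "(\<Sum>k\<in>?I. a' k t * h k) \<le> E * \<epsilon>"
    by (simp add: E_def mult_ac)
  have "?D = 2 * (\<Sum>k\<in>?I. a' k t * q k)"
    by (simp add: q_def inner_\<phi>r [OF t])
  also have "(\<Sum>k\<in>?I. a' k t * q k) = (\<Sum>k\<in>?I. a' k t * h k - real M / \<nu> * (a' k t)\<^sup>2)"
    by (intro sum.cong refl) (simp add: q right_diff_distrib power2_eq_square)
  also have "\<dots> = (\<Sum>k\<in>?I. a' k t * h k) - real M / \<nu> * \<epsilon>\<^sup>2"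
    by (simp add: sum_subtractf sum_distrib_left \<epsilon>)
  also have "2 * \<dots> \<le> \<nu> * E\<^sup>2"
  proof -
    \<comment> \<open>The square encodes Young's inequality 2 E \<epsilon> \<le> \<nu> E^2 +
      \<epsilon>^2 / \<nu>. The second summand is what the dissipation 2 M \<epsilon>^2 / \<nu>
      leaves after absorbing \<epsilon>^2 / \<nu>; it is nonnegative because M is at least
      1.\<close>
    have "0 \<le> (\<nu> * E - \<epsilon>)\<^sup>2 / \<nu> + (2 * real M - 1) / \<nu> * \<epsilon>\<^sup>2"
      using \<open>\<nu> > 0\<close> M by (intro add_nonneg_nonneg mult_nonneg_nonneg divide_nonneg_pos) auto
    also have "\<dots> = \<nu> * E\<^sup>2 - 2 * (E * \<epsilon> - real M / \<nu> * \<epsilon>\<^sup>2)"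
      using \<open>\<nu> > 0\<close> by (simp add: field_simps power2_eq_square)
    finally have "2 * (E * \<epsilon> - real M / \<nu> * \<epsilon>\<^sup>2) \<le> \<nu> * E\<^sup>2" by simp
    moreover have "2 * ((\<Sum>k\<in>?I. a' k t * h k) - real M / \<nu> * \<epsilon>\<^sup>2) \<le> 2 * (E * \<epsilon> - real M / \<nu> * \<epsilon>\<^sup>2)"
      using h_le by simp
    ultimately show ?thesis by (rule order_trans [rotated])
  qed
  finally have "?D \<le> \<nu> * C\<^sup>2 * (L2_norm \<Omega> (grad \<Omega> (\<eta> t)))\<^sup>2"
    by (simp add: E_def power_mult_distrib mult.assoc)
  with deriv show "\<exists>D. ((\<lambda>\<tau>. (L2_norm \<Omega> (grad \<Omega> (\<phi>\<^sub>r \<tau>)))\<^sup>2) has_real_derivative D) (at t within {0..T}) \<and>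
      D \<le> \<nu> * C\<^sup>2 * (L2_norm \<Omega> (grad \<Omega> (\<eta> t)))\<^sup>2"
    by blast
qed

end
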